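(* Let $2\le m<n$ be integers and let $E=K(n,m,\mathcal D)\in\mathcal M_{t,v,r}(n,m)$. Let $N=\#\mathcal D$, let $s=\#\{j: a_j>0\}$ be the number of non-vacant rows of $\mathcal D$, let $\sigma=\log m/\log n$, $\alpha=1/\sigma-\lfloor 1/\sigma\rfloor$, and for $k\ge 1$ let $\delta_k=\lfloor k\alpha\rfloor-\lfloor (k-1)\alpha\rfloor$ and $$n_k=N s^{\lfloor 1/\sigma\rfloor+\delta_k-1},\qquad \Omega=\prod_{k=1}^\infty\{0,1,\dots,n_k-1\}.$$ Then $E\sim(\Omega,d_{1/n})$. In particular, if $\sigma=p/q\in\mathbb Q$ with $p,q$ positive integers, then $E\sim(\{0,1,\dots,N^*-1\}^\infty,d_{1/n^p})$, where $N^*=N^p s^{q-p}$.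
   Context: For $\mathcal D\subset\{0,\dots,n-1\}\times\{0,\dots,m-1\}$ and $d\in\mathcal D$ let $S_d(z)=\mathrm{diag}(n^{-1},m^{-1})(z+d)$ for $z\in\mathbb R^2$. $K(n,m,\mathcal D)$ denotes the unique non-empty compact set $E\subset\mathbb R^2$ with $E=\bigcup_{d\in\mathcal D}S_d(E)$ (a self-affine, or Bedford–McMullen, carpet); it carries the Euclidean metric. It is always assumed that $\#\mathcal D>1$. Put $a_j=\#\{i:(i,j)\in\mathcal D\}$ for $0\le j\le m-1$; the sequence $(a_j)_{j=0}^{m-1}$ is the distribution sequence. Row $j$ is vacant if $a_j=0$. $E$ has uniform horizontal fibers if all non-zero $a_j$ are equal. $\mathcal M_{t,v,r}(n,m)$ is the class of carpets $K(n,m,\mathcal D)$ that are totally disconnected, possess at least one vacant row, and have uniform horizontal fibers. Two metric spaces $(X,d_X)$, $(Y,d_Y)$ are Lipschitz equivalent, written $X\sim Y$, if there are a bijection $f:X\to Y$ and a constant $C>0$ with $C^{-1}d_X(x,y)\le d_Y(f(x),f(y))\le C\,d_X(x,y)$ for all $x,y\in X$. For $\xi\in(0,1)$ and infinite integer sequences $\mathbf x,\mathbf x'$, $d_\xi(\mathbf x,\mathbf x')=\xi^{|\mathbf x\wedge\mathbf x'|}$, where $|\mathbf x\wedge\mathbf x'|$ is the length of the maximal common prefix of $\mathbf x$ and $\mathbf x'$ (and $d_\xi(\mathbf x,\mathbf x)=0$). *)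

theory Defs
  imports "HOL-Analysis.Analysis"
begin

section \<open>Self-affine carpets\<close>

text \<open>The plane is \<^typ>\<open>real \<times> real\<close>, whose \<^const>\<open>dist\<close> is the Euclidean metric.
  A digit \<open>(i, j)\<close> has column index \<open>i < n\<close> and row index \<open>j < m\<close>.\<close>

definition digit_map :: "nat \<Rightarrow> nat \<Rightarrow> nat \<times> nat \<Rightarrow> real \<times> real \<Rightarrow> real \<times> real" where
  "digit_map n m d z = ((fst z + real (fst d)) / real n, (snd z + real (snd d)) / real m)"

definition is_attractor :: "nat \<Rightarrow> nat \<Rightarrow> (nat \<times> nat) set \<Rightarrow> (real \<times> real) set \<Rightarrow> bool" where
  "is_attractor n m D E \<longleftrightarrow> E \<noteq> {} \<and> compact E \<and> E = (\<Union>d\<in>D. digit_map n m d ` E)"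

text \<open>Well defined for \<open>n, m \<ge> 2\<close> and finite non-empty \<open>D\<close>, see \<open>ex1_attractor\<close> below.\<close>

definition carpet :: "nat \<Rightarrow> nat \<Rightarrow> (nat \<times> nat) set \<Rightarrow> (real \<times> real) set" where
  "carpet n m D = (THE E. is_attractor n m D E)"

definition row_count :: "(nat \<times> nat) set \<Rightarrow> nat \<Rightarrow> nat" where
  "row_count D j = card {i. (i, j) \<in> D}"

definition has_vacant_row :: "nat \<Rightarrow> (nat \<times> nat) set \<Rightarrow> bool" where
  "has_vacant_row m D \<longleftrightarrow> (\<exists>j<m. row_count D j = 0)"

definition uniform_horizontal_fibers :: "nat \<Rightarrow> (nat \<times> nat) set \<Rightarrow> bool" where
  "uniform_horizontal_fibers m D \<longleftrightarrow>
     (\<forall>j<m. \<forall>j'<m. row_count D j \<noteq> 0 \<longrightarrow> row_count D j' \<noteq> 0 \<longrightarrow> row_count D j = row_count D j')"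

definition totally_disconnected :: "'a::topological_space set \<Rightarrow> bool" where
  "totally_disconnected E \<longleftrightarrow> (\<forall>x\<in>E. connected_component_set E x = {x})"

text \<open>Membership of \<open>K(n,m,D)\<close> in the class \<open>M\<^sub>t\<^sub>,\<^sub>v\<^sub>,\<^sub>r(n,m)\<close>. Vacant rows and uniform fibers
  are conditions on the digit set presenting the carpet, so this is a predicate on \<open>D\<close>.\<close>

definition in_M_tvr :: "nat \<Rightarrow> nat \<Rightarrow> (nat \<times> nat) set \<Rightarrow> bool" where
  "in_M_tvr n m D \<longleftrightarrow>
     totally_disconnected (carpet n m D) \<and> has_vacant_row m D \<and> uniform_horizontal_fibers m D"


section \<open>Lipschitz equivalence and sequence spaces\<close>

definition lipschitz_equivalent ::
    "'a set \<Rightarrow> ('a \<Rightarrow> 'a \<Rightarrow> real) \<Rightarrow> 'b set \<Rightarrow> ('b \<Rightarrow> 'b \<Rightarrow> real) \<Rightarrow> bool" where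
  "lipschitz_equivalent X dX Y dY \<longleftrightarrow>
     (\<exists>f C. bij_betw f X Y \<and> C > 0 \<and>
        (\<forall>x\<in>X. \<forall>y\<in>X. inverse C * dX x y \<le> dY (f x) (f y) \<and> dY (f x) (f y) \<le> C * dX x y))"

text \<open>Used for distinct sequences only; for equal ones the maximum does not exist.\<close>

definition common_prefix_length :: "(nat \<Rightarrow> 'a) \<Rightarrow> (nat \<Rightarrow> 'a) \<Rightarrow> nat" where
  "common_prefix_length x y = (GREATEST l. \<forall>i<l. x i = y i)"

definition seq_dist :: "real \<Rightarrow> (nat \<Rightarrow> 'a) \<Rightarrow> (nat \<Rightarrow> 'a) \<Rightarrow> real" where
  "seq_dist \<xi> x y = (if x = y then 0 else \<xi> ^ common_prefix_length x y)"

text \<open>The product of the sets \<open>{0, \<dots>, c k - 1}\<close> over \<open>k \<ge> 1\<close>. Sequences are indexed from 0,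
  so the factor with index \<open>k\<close> is at position \<open>k - 1\<close>.\<close>

definition seq_space :: "(nat \<Rightarrow> nat) \<Rightarrow> (nat \<Rightarrow> nat) set" where
  "seq_space c = {x. \<forall>k. x k < c (Suc k)}"


section \<open>The parameters\<close>

definition sigma_nm :: "nat \<Rightarrow> nat \<Rightarrow> real" where
  "sigma_nm n m = ln (real m) / ln (real n)"

definition alpha :: "nat \<Rightarrow> nat \<Rightarrow> real" where
  "alpha n m = 1 / sigma_nm n m - of_int \<lfloor>1 / sigma_nm n m\<rfloor>"

definition delta :: "nat \<Rightarrow> nat \<Rightarrow> nat \<Rightarrow> int" where
  "delta n m k = \<lfloor>real k * alpha n m\<rfloor> - \<lfloor>(real k - 1) * alpha n m\<rfloor>"

definition num_rows :: "nat \<Rightarrow> (nat \<times> nat) set \<Rightarrow> nat" where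
  "num_rows m D = card {j. j < m \<and> row_count D j > 0}"

text \<open>For \<open>2 \<le> m < n\<close> and \<open>k \<ge> 1\<close> the exponent is non-negative, as \<open>\<lfloor>1/\<sigma>\<rfloor> \<ge> 1\<close> and
  \<open>\<delta>\<^sub>k \<ge> 0\<close>, so \<^const>\<open>nat\<close> does not truncate.\<close>

definition n_seq :: "nat \<Rightarrow> nat \<Rightarrow> (nat \<times> nat) set \<Rightarrow> nat \<Rightarrow> nat" where
  "n_seq n m D k = card D * num_rows m D ^ nat (\<lfloor>1 / sigma_nm n m\<rfloor> + delta n m k - 1)"


section \<open>Well-definedness\<close>

lemma n_seq_exponent_nonneg:
  assumes "2 \<le> m" "m < n"
  shows "\<lfloor>1 / sigma_nm n m\<rfloor> + delta n m k - 1 \<ge> 0"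
proof -
  have "sigma_nm n m > 0" "sigma_nm n m \<le> 1"
    using assms by (auto simp: sigma_nm_def)
  then have "1 \<le> \<lfloor>1 / sigma_nm n m\<rfloor>" unfolding le_floor_iff by simp
  moreover have "alpha n m \<ge> 0" by (simp add: alpha_def)
  then have "\<lfloor>(real k - 1) * alpha n m\<rfloor> \<le> \<lfloor>real k * alpha n m\<rfloor>"
    by (intro floor_mono mult_right_mono) auto
  ultimately show ?thesis unfolding delta_def by linarith
qed

lemma common_prefix_length_eq_Least:
  assumes "x \<noteq> y"
  shows "common_prefix_length x y = (LEAST i. x i \<noteq> y i)"
proof -
  obtain k where k: "x k \<noteq> y k" using assms by auto
  let ?l = "LEAST i. x i \<noteq> y i"
  have l: "x ?l \<noteq> y ?l" using k by (rule LeastI)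
  show ?thesis unfolding common_prefix_length_def
  proof (rule Greatest_equality)
    show "\<forall>i<?l. x i = y i" using not_less_Least by blast
    show "z \<le> ?l" if "\<forall>i<z. x i = y i" for z using that l not_less by blast
  qed
qed

lemma seq_dist_le_max:
  assumes "0 < \<xi>" "\<xi> < 1"
  shows "seq_dist \<xi> x z \<le> max (seq_dist \<xi> x y) (seq_dist \<xi> y z)"
proof (cases "x = y \<or> y = z \<or> x = z")
  case True
  then show ?thesis using assms by (auto simp: seq_dist_def le_max_iff_disj)
next
  case False
  let ?l = "LEAST i. x i \<noteq> z i"
  have "\<exists>i. x i \<noteq> z i" using False by auto
  then have "x ?l \<noteq> z ?l" by (rule LeastI_ex)
  then have "x ?l \<noteq> y ?l \<or> y ?l \<noteq> z ?l" by auto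
  then have "(LEAST i. x i \<noteq> y i) \<le> ?l \<or> (LEAST i. y i \<noteq> z i) \<le> ?l"
    by (auto intro: Least_le)
  then show ?thesis
    using False assms
    by (auto simp: seq_dist_def common_prefix_length_eq_Least le_max_iff_disj
        intro: power_decreasing)
qed

lemma Metric_space_seq_dist:
  assumes "0 < \<xi>" "\<xi> < 1"
  shows "Metric_space X (seq_dist \<xi>)"
proof
  show nn: "0 \<le> seq_dist \<xi> x y" for x y :: "nat \<Rightarrow> 'a"
    using assms by (simp add: seq_dist_def)
  show "seq_dist \<xi> x y = seq_dist \<xi> y x" for x y :: "nat \<Rightarrow> 'a"
    by (simp add: seq_dist_def common_prefix_length_def eq_commute)
  show "seq_dist \<xi> x y = 0 \<longleftrightarrow> x = y" for x y :: "nat \<Rightarrow> 'a"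
    using assms by (simp add: seq_dist_def)
  show "seq_dist \<xi> x z \<le> seq_dist \<xi> x y + seq_dist \<xi> y z" for x y z :: "nat \<Rightarrow> 'a"
    using seq_dist_le_max[OF assms, of x z y] nn[of x y] nn[of y z] by linarith
qed

lemma dist_digit_map_le:
  assumes "2 \<le> n" "2 \<le> m"
  shows "dist (digit_map n m d z) (digit_map n m d w) \<le> dist z w / 2"
proof -
  have *: "(dist ((a + c) / real k) ((b + c) / real k))\<^sup>2 \<le> (dist a b)\<^sup>2 / 4"
    if "2 \<le> k" for a b c :: real and k :: nat
  proof -
    have "dist ((a + c) / real k) ((b + c) / real k) = \<bar>a - b\<bar> / real k"
      by (simp add: dist_real_def diff_divide_distrib[symmetric])
    also have "\<dots> \<le> \<bar>a - b\<bar> / 2"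
      using that by (intro divide_left_mono) auto
    finally have "(dist ((a + c) / real k) ((b + c) / real k))\<^sup>2 \<le> (\<bar>a - b\<bar> / 2)\<^sup>2"
      by (intro power_mono) auto
    then show ?thesis by (simp add: dist_real_def power_divide)
  qed
  have "(dist (digit_map n m d z) (digit_map n m d w))\<^sup>2 \<le> (dist z w / 2)\<^sup>2"
    using *[OF assms(1), of "fst z" "real (fst d)" "fst w"]
      *[OF assms(2), of "snd z" "real (snd d)" "snd w"]
    by (simp add: digit_map_def dist_prod_def power_divide add_divide_distrib[symmetric])
  then show ?thesis by (rule power2_le_imp_le) simp
qed

lemma continuous_on_digit_map: "continuous_on S (digit_map n m d)"
  unfolding digit_map_def divide_inverse by (intro continuous_intros)

lemma attractor_subset:
  assumes "2 \<le> n" "2 \<le> m" "is_attractor n m D E" "is_attractor n m D F"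
  shows "E \<subseteq> F"
proof
  obtain B where B: "\<And>x y. x \<in> E \<Longrightarrow> y \<in> F \<Longrightarrow> dist x y \<le> B"
  proof -
    have "bounded (E \<union> F)"
      using assms by (simp add: is_attractor_def compact_imp_bounded)
    then obtain z e where "\<And>x. x \<in> E \<union> F \<Longrightarrow> dist z x \<le> e"
      unfolding bounded_def by metis
    then have "dist x y \<le> e + e" if "x \<in> E" "y \<in> F" for x y
      using that dist_triangle3[of x y z] by (smt (verit) UnI1 UnI2)
    then show ?thesis using that by blast
  qed
  obtain y0 where y0: "y0 \<in> F" using assms by (auto simp: is_attractor_def)
  have appr: "\<exists>y\<in>F. dist x y \<le> B / 2 ^ k" if "x \<in> E" for x k
    using that
  proof (induction k arbitrary: x)
    case 0
    then show ?case using B[OF _ y0] y0 by (intro bexI[of _ y0]) simp_all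
  next
    case (Suc k)
    then obtain d x' where d: "d \<in> D" "x' \<in> E" "x = digit_map n m d x'"
      using assms(3) unfolding is_attractor_def by blast
    obtain y' where y': "y' \<in> F" "dist x' y' \<le> B / 2 ^ k" using Suc.IH d by blast
    have "digit_map n m d y' \<in> F"
      using assms(4) d y' unfolding is_attractor_def by blast
    moreover have "dist x (digit_map n m d y') \<le> B / 2 ^ Suc k"
      using dist_digit_map_le[OF assms(1,2), of d x' y'] y' d by simp
    ultimately show ?case by blast
  qed
  fix x assume x: "x \<in> E"
  have "x \<in> closure F"
    unfolding closure_approachable
  proof (intro allI impI)
    fix e :: real assume "e > 0"
    have "(\<lambda>k. B / 2 ^ k) \<longlonglongrightarrow> 0"
      using LIMSEQ_divide_realpow_zero[of 2 B] by simp
    then have "eventually (\<lambda>k. B / 2 ^ k < e) sequentially"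
      using \<open>e > 0\<close> by (rule order_tendstoD)
    then obtain k where "B / 2 ^ k < e" by (auto simp: eventually_sequentially)
    then show "\<exists>y\<in>F. dist y x < e"
      using appr[OF x, of k] by (metis dist_commute order_le_less_trans)
  qed
  then show "x \<in> F" using assms(4)
    by (simp add: is_attractor_def compact_imp_closed closure_closed)
qed

lemma ex_attractor:
  assumes "2 \<le> n" "2 \<le> m" "finite D" "D \<noteq> {}"
  shows "\<exists>E. is_attractor n m D E"
proof -
  define H where "H = (\<lambda>X. \<Union>d\<in>D. digit_map n m d ` X)"
  define M where "M = Max ((\<lambda>d. real (fst d + snd d)) ` D)"
  define Q where "Q = {0..M} \<times> {0..M}"
  have M: "real (fst d) \<le> M" "real (snd d) \<le> M" "0 \<le> M" if "d \<in> D" for d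
  proof -
    have "real (fst d + snd d) \<le> M"
      unfolding M_def using assms that by (intro Max_ge) auto
    then show "real (fst d) \<le> M" "real (snd d) \<le> M" "0 \<le> M" by auto
  qed
  have M0: "0 \<le> M" using M(3) assms by blast
  have half: "(a + b) / real k \<le> M" if "2 \<le> k" "a \<le> M" "b \<le> M" for a b k
  proof -
    have "M * 2 \<le> M * real k" using that M0 by (intro mult_left_mono) auto
    then show ?thesis using that by (simp add: divide_le_eq)
  qed
  have HQ: "H Q \<subseteq> Q"
    using M assms by (auto simp: H_def Q_def digit_map_def half)
  have mono: "H X \<subseteq> H Y" if "X \<subseteq> Y" for X Y using that by (auto simp: H_def)
  define X where "X = (\<lambda>k. (H ^^ k) Q)"
  have XS: "X (Suc k) = H (X k)" for k by (simp add: X_def)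
  have dec: "X (Suc k) \<subseteq> X k" for k
  proof (induction k)
    case 0 then show ?case using HQ by (simp add: X_def)
  next
    case (Suc k) then show ?case using mono XS by metis
  qed
  have comp: "compact (X k) \<and> X k \<noteq> {}" for k
  proof (induction k)
    case 0 then show ?case using M0 by (auto simp: X_def Q_def intro: compact_Times)
  next
    case (Suc k)
    then show ?case unfolding XS H_def using assms
      by (auto intro!: compact_UN compact_continuous_image continuous_on_digit_map)
  qed
  have anti: "X l \<subseteq> X k" if "k \<le> l" for k l
    using lift_Suc_antimono_le[of X, OF dec that] .
  define E where "E = (\<Inter>k. X k)"
  have "E \<noteq> {}" unfolding E_def
    by (rule compact_nest) (use comp anti in auto)
  moreover have "compact E" unfolding E_def
    by (rule compact_Inter) (use comp in auto)
  moreover have "H E \<subseteq> E"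
  proof -
    have "H E \<subseteq> X k" for k
    proof -
      have "H E \<subseteq> H (X k)" by (rule mono) (auto simp: E_def)
      then show ?thesis using XS dec by blast
    qed
    then show ?thesis by (auto simp: E_def)
  qed
  moreover have "E \<subseteq> H E"
  proof
    fix x assume x: "x \<in> E"
    have "\<forall>k. \<exists>d\<in>D. x \<in> digit_map n m d ` X k"
      using x XS by (fastforce simp: E_def H_def)
    then obtain f where f: "\<And>k. f k \<in> D" "\<And>k. x \<in> digit_map n m (f k) ` X k" by metis
    have "\<exists>d\<in>D. infinite {k \<in> UNIV. f k = d}"
      by (rule pigeonhole_infinite_rel) (use f assms in auto)
    then obtain d where d: "d \<in> D" "infinite {k. f k = d}" by auto
    have all: "x \<in> digit_map n m d ` X k" for k
    proof -
      obtain l where "l \<ge> k" "f l = d"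
        using d(2) unfolding infinite_nat_iff_unbounded_le by blast
      then show ?thesis using f(2)[of l] anti by blast
    qed
    have inj: "inj (digit_map n m d)"
      using assms by (auto simp: inj_def digit_map_def prod_eq_iff)
    have "x \<in> digit_map n m d ` E"
      unfolding E_def using all inj by (auto simp: image_INT[OF inj])
    then show "x \<in> H E" using d by (auto simp: H_def)
  qed
  ultimately have "is_attractor n m D E" by (auto simp: is_attractor_def H_def)
  then show ?thesis ..
qed

lemma ex1_attractor:
  assumes "2 \<le> n" "2 \<le> m" "finite D" "D \<noteq> {}"
  shows "\<exists>!E. is_attractor n m D E"
  using ex_attractor[OF assms] attractor_subset[OF assms(1,2)] by blast

lemma carpet_is_attractor:
  assumes "2 \<le> n" "2 \<le> m" "finite D" "D \<noteq> {}"
  shows "is_attractor n m D (carpet n m D)"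
  unfolding carpet_def by (rule theI'[OF ex1_attractor[OF assms]])

end

theory Submission
  imports Defs
begin

text \<open>Let \<open>L k\<close> be the integer part of \<open>k / \<sigma>\<close>. A rectangle of width \<open>n\<close> to the power \<open>-k\<close> and height
  \<open>m\<close> to the power \<open>-L k\<close> is, up to the factor \<open>m\<close>, a square. Such an approximate square of
  generation \<open>k\<close> is given by the first \<open>k\<close> column digits and the first \<open>L k\<close> row digits of a
  sequence of digits in \<open>D\<close>. Because all non-vacant rows have the same number \<open>a\<close> of digits, every
  approximate square has the same number of children in the next generation, and this number is
  exactly the number that defines the factor of \<open>\<Omega>\<close>. So \<open>\<Omega>\<close> is the tree of approximate squares,
  metrised as if different squares of one generation were always apart. In the carpet they may
  touch, so the obvious coding of the carpet by \<open>\<Omega>\<close> is not bi-Lipschitz and has to be replaced.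

  The remedy is to compare \<open>\<Omega>\<close> with the clusters, the connected components of the relation of
  touching among the squares of one generation. The number of squares in a cluster is bounded.
  Vertically a cluster cannot cross a vacant row (\<open>conn_row_less\<close>). Horizontally, total
  disconnectedness forces \<open>a < n\<close>, since a full row produces a horizontal segment
  (\<open>not_totally_disconnected_if_full_row\<close>); a cluster meets at most \<open>m\<close> rows of squares, and for
  large \<open>t\<close> these occupy at most \<open>m * a ^ t < n ^ t\<close> of the columns in a block of \<open>n ^ t\<close>
  columns, so that every block has a free column (\<open>conn_col_less\<close>). Hence different clusters of
  generation \<open>k\<close> have a distance of at least the order of the side length, a single one has a
  diameter of at most that order, and the carpet is bi-Lipschitz to the tree of clusters.

  It remains to match a tree with bounded integer weights (the number of squares in a cluster)
  with the tree \<open>\<Omega>\<close> (\<open>lipschitz_equivalent_of_weighted_tree\<close>). A node of weight \<open>w\<close> is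
  to own \<open>w\<close> cylinders of \<open>\<Omega>\<close> of the same generation that have a common parent. To pass on the
  cylinders to the children of the node, the children have to be packed into \<open>w\<close> bins whose
  capacity is the number of children of one cylinder, without any loss. Greedy filling leaves a
  gap smaller than the largest weight in each bin, and the gaps can be closed if there are
  enough children of weight one (\<open>pack_bins\<close>). Passing from one generation to a much later
  one makes the children numerous.

  Clusters need not have weight one: if \<open>D\<close> consists of two touching digits in one column, all
  clusters of positive generation have an even number of squares. So some clusters are cut into two pieces,
  one of them of weight one. This is possible if all rows of the cluster agree in their first
  \<open>k + 1\<close> digits (\<open>splits_if_homogeneous\<close>). Then the cluster is the product of a run of columns and
  a run of rows. A vacant column digit and the vacant row digit split each of its squares into
  quarters (some of them may be empty) that do not touch, and the four quarters at the four corners of the cluster together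
  have the weight of one square and touch nothing else. As \<open>L k - k\<close> tends to infinity, each
  square of a late generation meets such a cluster three generations later
  (\<open>ex_split_below\<close>).

  If \<open>\<sigma> = p / q\<close>, the factors of \<open>\<Omega>\<close> are periodic with period \<open>p\<close>, and grouping
  coordinates into blocks of length \<open>p\<close> gives the second claim.\<close>


section \<open>Lipschitz equivalence and blocks of sequences\<close>

lemma lipschitz_equivalent_sym:
  assumes "lipschitz_equivalent X dX Y dY"
  shows "lipschitz_equivalent Y dY X dX"
proof -
  obtain f C where f: "bij_betw f X Y" and C: "C > 0"
    and b: "\<And>x y. x \<in> X \<Longrightarrow> y \<in> X \<Longrightarrow>
      inverse C * dX x y \<le> dY (f x) (f y) \<and> dY (f x) (f y) \<le> C * dX x y"
    using assms unfolding lipschitz_equivalent_def by blast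
  let ?g = "inv_into X f"
  have g: "bij_betw ?g Y X" using f by (rule bij_betw_inv_into)
  have "inverse C * dY u v \<le> dX (?g u) (?g v) \<and> dX (?g u) (?g v) \<le> C * dY u v"
    if "u \<in> Y" "v \<in> Y" for u v
  proof -
    have "?g u \<in> X" "?g v \<in> X" "f (?g u) = u" "f (?g v) = v"
      using that f g by (auto simp: bij_betw_inv_into_right dest: bij_betwE)
    then have "inverse C * dX (?g u) (?g v) \<le> dY u v" "dY u v \<le> C * dX (?g u) (?g v)"
      using b[of "?g u" "?g v"] by auto
    then show ?thesis using C by (simp add: field_simps)
  qed
  then show ?thesis unfolding lipschitz_equivalent_def using g C by blast
qed

lemma lipschitz_equivalent_trans:
  assumes "lipschitz_equivalent X dX Y dY" "lipschitz_equivalent Y dY Z dZ"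
  shows "lipschitz_equivalent X dX Z dZ"
proof -
  obtain f C where f: "bij_betw f X Y" and C: "C > 0"
    and b: "\<And>x y. x \<in> X \<Longrightarrow> y \<in> X \<Longrightarrow>
      inverse C * dX x y \<le> dY (f x) (f y) \<and> dY (f x) (f y) \<le> C * dX x y"
    using assms(1) unfolding lipschitz_equivalent_def by blast
  obtain g C' where g: "bij_betw g Y Z" and C': "C' > 0"
    and b': "\<And>x y. x \<in> Y \<Longrightarrow> y \<in> Y \<Longrightarrow>
      inverse C' * dY x y \<le> dZ (g x) (g y) \<and> dZ (g x) (g y) \<le> C' * dY x y"
    using assms(2) unfolding lipschitz_equivalent_def by blast
  have "inverse (C' * C) * dX x y \<le> dZ ((g \<circ> f) x) ((g \<circ> f) y) \<and>
      dZ ((g \<circ> f) x) ((g \<circ> f) y) \<le> (C' * C) * dX x y" if "x \<in> X" "y \<in> X" for x y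
  proof -
    have fY: "f x \<in> Y" "f y \<in> Y" using that f by (auto dest: bij_betwE)
    have "inverse C' * (inverse C * dX x y) \<le> inverse C' * dY (f x) (f y)"
      using b[OF that] C' by (intro mult_left_mono) auto
    moreover have "C' * dY (f x) (f y) \<le> C' * (C * dX x y)"
      using b[OF that] C' by (intro mult_left_mono) auto
    ultimately show ?thesis using b'[OF fY] by (simp add: mult.assoc) 
  qed
  moreover have "bij_betw (g \<circ> f) X Z" using f g by (rule bij_betw_trans)
  ultimately show ?thesis unfolding lipschitz_equivalent_def using C C' by (meson mult_pos_pos)
qed

lemma seq_dist_cases:
  assumes "x \<noteq> y"
  obtains K where "\<And>i. i < K \<Longrightarrow> x i = y i" "x K \<noteq> y K" "\<And>\<xi>. seq_dist \<xi> x y = \<xi> ^ K"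
proof
  let ?K = "LEAST i. x i \<noteq> y i"
  show "x i = y i" if "i < ?K" for i using not_less_Least[OF that] by simp
  have "\<exists>i. x i \<noteq> y i" using assms by auto
  then show "x ?K \<noteq> y ?K" by (rule LeastI_ex)
  show "seq_dist \<xi> x y = \<xi> ^ ?K" for \<xi>
    using assms by (simp add: seq_dist_def common_prefix_length_eq_Least)
qed

lemma seq_dist_eqI:
  assumes "\<And>i. i < K \<Longrightarrow> x i = y i" "x K \<noteq> y K"
  shows "seq_dist \<xi> x y = \<xi> ^ K"
proof -
  have "x \<noteq> y" using assms(2) by auto
  then obtain K' where K': "\<And>i. i < K' \<Longrightarrow> x i = y i" "x K' \<noteq> y K'" "seq_dist \<xi> x y = \<xi> ^ K'"
    by (rule seq_dist_cases) blast
  have "K = K'" using assms K' by (metis linorder_neqE_nat)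
  then show ?thesis using K' by simp
qed

text \<open>If two sequences first differ at position \<open>K\<close>, the sequences of their blocks of length \<open>R\<close> first
  differ at block \<open>K div R\<close>, and \<open>R * (K div R)\<close> is \<open>K\<close> up to an error less than \<open>R\<close>.\<close>

lemma lipschitz_equivalent_blocks:
  assumes "0 < \<xi>" "\<xi> < 1" "0 < R"
    and c': "\<And>k. c' (Suc k) = (\<Prod>i<R. c (Suc (k * R + i)))"
  shows "lipschitz_equivalent (seq_space c) (seq_dist \<xi>) (seq_space c') (seq_dist (\<xi> ^ R))"
proof -
  define B where "B k = Pi\<^sub>E {..<R} (\<lambda>i. {..<c (Suc (k * R + i))})" for k
  have "\<exists>g. bij_betw g (B k) {..<c' (Suc k)}" for k
    by (rule finite_same_card_bij) (auto simp: B_def c' card_PiE intro: finite_PiE)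
  then obtain g where g: "\<And>k. bij_betw (g k) (B k) {..<c' (Suc k)}" by metis
  define blk where "blk x k = restrict (\<lambda>i. x (k * R + i)) {..<R}" for x :: "nat \<Rightarrow> nat" and k
  have blkB: "blk x k \<in> B k" if "x \<in> seq_space c" for x k
    using that by (auto simp: blk_def B_def seq_space_def)
  have split: "t = t div R * R + t mod R" "t mod R < R" for t using assms by auto
  have blk_eq: "blk x k = blk y k \<longleftrightarrow> (\<forall>i<R. x (k * R + i) = y (k * R + i))" for x y k
    unfolding blk_def by (auto simp: fun_eq_iff restrict_def)
  define f where "f x k = g k (blk x k)" for x k
  have f_eq: "f x k = f y k \<longleftrightarrow> (\<forall>i<R. x (k * R + i) = y (k * R + i))"
    if "x \<in> seq_space c" "y \<in> seq_space c" for x y k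
    unfolding f_def blk_eq[symmetric]
    by (rule inj_on_eq_iff[OF bij_betw_imp_inj_on[OF g] blkB[OF that(1)] blkB[OF that(2)]])
  have "bij_betw f (seq_space c) (seq_space c')"
  proof (rule bij_betwI')
    show "f x = f y \<longleftrightarrow> x = y" if "x \<in> seq_space c" "y \<in> seq_space c" for x y
    proof
      assume "f x = f y"
      then have "f x k = f y k" for k by simp
      then have "x (k * R + i) = y (k * R + i)" if "i < R" for k i
        using f_eq[OF \<open>x \<in> _\<close> \<open>y \<in> _\<close>] that by blast
      then have "x t = y t" for t using split[of t] by metis
      then show "x = y" by auto
    qed auto
    show "f x \<in> seq_space c'" if "x \<in> seq_space c" for x
      using g blkB[OF that] unfolding f_def seq_space_def bij_betw_def by blast
    show "\<exists>x\<in>seq_space c. y = f x" if y: "y \<in> seq_space c'" for y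
    proof -
      define h where "h k = inv_into (B k) (g k) (y k)" for k
      have yk: "y k \<in> {..<c' (Suc k)}" for k using y by (simp add: seq_space_def)
      have h: "h k \<in> B k" "g k (h k) = y k" for k
        using g[of k] yk[of k] unfolding h_def
        by (metis bij_betw_def inv_into_into, metis bij_betw_inv_into_right)
      define x where "x t = h (t div R) (t mod R)" for t
      have "x t < c (Suc t)" for t
        using h(1)[of "t div R"] split[of t] unfolding B_def x_def
        by (metis PiE_mem lessThan_iff)
      then have "x \<in> seq_space c" by (simp add: seq_space_def)
      moreover have "blk x k = h k" for k
      proof
        show "blk x k i = h k i" for i
        proof (cases "i < R")
          case False
          then show ?thesis using PiE_arb[OF h(1)[of k, unfolded B_def], of i]
            by (simp add: blk_def)
        qed (simp add: blk_def x_def)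
      qed
      then have "f x = y" by (intro ext) (simp add: f_def h)
      ultimately show ?thesis by auto
    qed
  qed
  moreover have "inverse (inverse (\<xi> ^ R)) * seq_dist \<xi> x y \<le> seq_dist (\<xi> ^ R) (f x) (f y) \<and>
      seq_dist (\<xi> ^ R) (f x) (f y) \<le> inverse (\<xi> ^ R) * seq_dist \<xi> x y"
    if x: "x \<in> seq_space c" and y: "y \<in> seq_space c" for x y
  proof (cases "x = y")
    case False
    then obtain K where K: "\<And>i. i < K \<Longrightarrow> x i = y i" "x K \<noteq> y K" "seq_dist \<xi> x y = \<xi> ^ K"
      by (rule seq_dist_cases) blast
    have "f x k = f y k" if "k < K div R" for k
    proof -
      have "k * R + i < K" if "i < R" for i
      proof -
        have "k * R + i < (k + 1) * R" using that by simp
        also have "\<dots> \<le> K div R * R" using \<open>k < _\<close> by (intro mult_right_mono) auto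
        finally show ?thesis using div_times_less_eq_dividend[of K R] by linarith
      qed
      then show ?thesis using f_eq[OF x y] K by blast
    qed
    moreover have "f x (K div R) \<noteq> f y (K div R)"
      using f_eq[OF x y] K(2) split[of K] by metis
    ultimately have d: "seq_dist (\<xi> ^ R) (f x) (f y) = (\<xi> ^ R) ^ (K div R)"
      by (rule seq_dist_eqI)
    have "\<xi> ^ K \<le> \<xi> ^ (R * (K div R))"
      using assms by (intro power_decreasing) auto
    moreover have "\<xi> ^ (R * (K div R) + R) \<le> \<xi> ^ K"
    proof (intro power_decreasing)
      show "K \<le> R * (K div R) + R" using split[of K]
        by (metis add_left_mono less_imp_le mult.commute)
    qed (use assms in auto)
    moreover have "\<xi> ^ R * \<xi> ^ K \<le> \<xi> ^ K"
      using assms by (simp add: mult_left_le_one_le power_le_one)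
    moreover have "\<xi> ^ R > 0" using assms by simp
    ultimately show ?thesis unfolding d K(3) power_mult[symmetric]
      by (auto simp: field_simps power_add)
  qed (simp add: seq_dist_def)
  moreover have "inverse (\<xi> ^ R) > 0" using assms by simp
  ultimately show ?thesis unfolding lipschitz_equivalent_def by blast
qed


section \<open>Packing weighted items into bins\<close>

lemma sum_le_one_of_pos:
  fixes w :: "'a \<Rightarrow> nat"
  assumes "finite S" "sum w S = 1" "\<And>A. A \<in> S \<Longrightarrow> w A \<ge> 1"
  shows "\<exists>A. S = {A} \<and> w A = 1"
proof -
  have "(\<Sum>A\<in>S. 1) \<le> sum w S" using assms by (intro sum_mono) auto
  then have "card S \<le> 1" using assms by simp
  moreover have "S \<noteq> {}" using assms by auto
  ultimately have "card S = 1" using assms(1) by (simp add: card_gt_0_iff le_antisym Suc_leI)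
  then obtain A where "S = {A}" by (auto simp: card_1_singleton_iff)
  then show ?thesis using assms by auto
qed

text \<open>Items are added as long as they fit; the first one that does not fit has a weight of at most \<open>M\<close>,
  which bounds the gap. The maximum with \<open>1\<close> is for \<open>M = 0\<close>.\<close>

lemma greedy_subset:
  fixes w :: "'a \<Rightarrow> nat"
  assumes "finite S" "\<And>A. A \<in> S \<Longrightarrow> w A \<le> M" "N \<le> sum w S"
  shows "\<exists>T\<subseteq>S. sum w T \<le> N \<and> N < sum w T + max 1 M"
  using assms
proof (induction S arbitrary: N rule: finite_induct)
  case (insert A S)
  show ?case
  proof (cases "N \<le> sum w S")
    case True
    then show ?thesis using insert by (metis insertCI subset_insertI2)
  next
    case False
    show ?thesis
    proof (cases "sum w (insert A S) = N")
      case True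
      then show ?thesis by (intro exI[of _ "insert A S"]) auto
    next
      case F: False
      have "w A \<le> M" "N \<le> w A + sum w S" using insert by auto
      moreover have "sum w (insert A S) = w A + sum w S" using insert.hyps by simp
      ultimately have "sum w S \<le> N" "N < sum w S + max 1 M" using False F by linarith+
      then show ?thesis by (intro exI[of _ S]) auto
    qed
  qed
qed auto

text \<open>The bin is filled greedily with items of weight other than one; what is left, at most \<open>M\<close> unless
  these items are used up, is filled with items of weight one. The number \<open>r\<close> of remaining items of weight one is what the next bins
  need.\<close>

lemma exact_subset:
  fixes w :: "'a \<Rightarrow> nat"
  assumes "finite S" "\<And>A. A \<in> S \<Longrightarrow> w A \<le> M"
    and "M + r \<le> card {A\<in>S. w A = 1}"
    and large: "N + r \<le> sum w S"
  shows "\<exists>T\<subseteq>S. sum w T = N \<and> r \<le> card {A\<in>S - T. w A = 1}"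
proof -
  define ones where "ones = {A\<in>S. w A = 1}"
  define big where "big = S - ones"
  have fin: "finite ones" "finite big" using assms(1) by (auto simp: ones_def big_def)
  have S: "S = big \<union> ones" "big \<inter> ones = {}" by (auto simp: ones_def big_def)
  have w1: "w A = 1" if "A \<in> ones" for A using that by (simp add: ones_def)
  have so: "sum w X = card X" if "X \<subseteq> ones" for X
  proof -
    have "sum w X = (\<Sum>A\<in>X. 1)" using w1 that by (intro sum.cong) auto
    then show ?thesis by simp
  qed
  have tot: "sum w S = sum w big + card ones"
    using S fin so[of ones] by (simp add: sum.union_disjoint)
  have add: "sum w (B \<union> O') = sum w B + card O'" if "B \<subseteq> big" "O' \<subseteq> ones" for B O'
    using that S fin so[OF that(2)]
    by (subst sum.union_disjoint) (auto intro: finite_subset)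
  have rest: "card {A\<in>S - (B \<union> O'). w A = 1} = card ones - card O'" if "B \<subseteq> big" "O' \<subseteq> ones" for B O'
  proof -
    have "{A\<in>S - (B \<union> O'). w A = 1} = ones - O'"
      using that by (auto simp: ones_def big_def)
    then show ?thesis using that fin by (simp add: card_Diff_subset finite_subset)
  qed
  have main: "?thesis" if B: "B \<subseteq> big" "sum w B \<le> N" "N - sum w B + r \<le> card ones" for B
  proof -
    obtain O' where O': "O' \<subseteq> ones" "card O' = N - sum w B"
      using B(3) by (meson add_leD1 obtain_subset_with_card_n)
    then show ?thesis using add[OF B(1) O'(1)] rest[OF B(1) O'(1)] B
      by (intro exI[of _ "B \<union> O'"]) (use S in auto)
  qed
  show ?thesis
  proof (cases "N \<le> sum w big")
    case True
    then obtain B where B: "B \<subseteq> big" "sum w B \<le> N" "N < sum w B + max 1 M"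
      using greedy_subset[of big w M N] assms(2) fin S by blast
    have "N - sum w B \<le> M" using B(2,3) by (cases M) auto
    then have "N - sum w B + r \<le> card ones" using assms(3) unfolding ones_def by linarith
    then show ?thesis using main B by blast
  next
    case False
    have "N - sum w big + r \<le> card ones" using False tot large by linarith
    then show ?thesis using main[of big] False by simp
  qed
qed

lemma pack_bins:
  fixes w :: "'a \<Rightarrow> nat"
  assumes "finite W" "finite S" "\<And>A. A \<in> S \<Longrightarrow> 1 \<le> w A \<and> w A \<le> M"
    and "sum w S = card W * N" "card W * M \<le> card {A\<in>S. w A = 1}" "M \<le> N"
  shows "\<exists>bin. bin \<in> S \<rightarrow> W \<and> (\<forall>c\<in>W. sum w {A\<in>S. bin A = c} = N)"
  using assms(1,2,3,4,5)
proof (induction W arbitrary: S rule: finite_induct)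
  case empty
  then have "S = {}" by (fastforce simp: sum_eq_0_iff)
  then show ?case by simp
next
  case (insert c W)
  have "M * card W \<le> N * card W" using \<open>M \<le> N\<close> by simp
  then have "\<exists>T\<subseteq>S. sum w T = N \<and> card W * M \<le> card {A\<in>S - T. w A = 1}"
    using insert by (intro exact_subset[where M = M]) (auto simp: algebra_simps)
  then obtain T where T: "T \<subseteq> S" "sum w T = N" "card W * M \<le> card {A\<in>S - T. w A = 1}"
    by blast
  have "sum w (S - T) = card W * N"
    using T insert by (simp add: sum_diff_nat finite_subset)
  then obtain bin where bin: "bin \<in> (S - T) \<rightarrow> W"
      "\<And>c. c \<in> W \<Longrightarrow> sum w {A\<in>S - T. bin A = c} = N"
    using insert.IH[of "S - T"] insert.prems T by auto
  define bin' where "bin' A = (if A \<in> T then c else bin A)" for A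
  have "bin' \<in> S \<rightarrow> insert c W"
    using bin(1) unfolding Pi_iff by (simp add: bin'_def)
  moreover have "{A\<in>S. bin' A = c} = T" 
  proof -
    have "bin A \<noteq> c" if "A \<in> S - T" for A using bin(1) insert.hyps that by auto
    then show ?thesis using T(1) by (auto simp: bin'_def)
  qed
  moreover have "{A\<in>S. bin' A = c'} = {A\<in>S - T. bin A = c'}" if "c' \<in> W" for c'
    using that insert.hyps by (auto simp: bin'_def)
  ultimately show ?case using bin(2) T by (intro exI[of _ bin']) auto
qed

lemma distribute:
  fixes w :: "'a \<Rightarrow> nat"
  assumes "finite S" "sum w S = N"
  shows "\<exists>h. h \<in> {..<N} \<rightarrow> S \<and> (\<forall>A\<in>S. card {i. i < N \<and> h i = A} = w A)"
proof -
  have "card (SIGMA A:S. {..<w A}) = N" using assms by (subst card_SigmaI) auto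
  then have "\<exists>b. bij_betw b {..<N} (SIGMA A:S. {..<w A})"
    using assms(1) by (intro finite_same_card_bij) auto
  then obtain b where b: "bij_betw b {..<N} (SIGMA A:S. {..<w A})" by blast
  have "card {i. i < N \<and> fst (b i) = A} = w A" if "A \<in> S" for A
  proof -
    have "b ` {i. i < N \<and> fst (b i) = A} = {A} \<times> {..<w A}"
    proof (intro set_eqI iffI)
      fix p assume "p \<in> {A} \<times> {..<w A}"
      then have "p \<in> b ` {..<N}" "fst p = A" using b that by (auto simp: bij_betw_def)
      then show "p \<in> b ` {i. i < N \<and> fst (b i) = A}" by auto
    next
      fix p assume "p \<in> b ` {i. i < N \<and> fst (b i) = A}"
      then obtain i where i: "i < N" "fst (b i) = A" "p = b i" by auto
      have "b i \<in> (SIGMA A:S. {..<w A})" using b i by (auto simp: bij_betw_def)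
      then show "p \<in> {A} \<times> {..<w A}" using i by (cases p) auto
    qed
    moreover have "inj_on b {i. i < N \<and> fst (b i) = A}"
      using b unfolding bij_betw_def by (auto intro: inj_on_subset)
    ultimately show ?thesis
      using card_image[of b "{i. i < N \<and> fst (b i) = A}"] by (simp add: card_cartesian_product)
  qed
  moreover have "(fst \<circ> b) \<in> {..<N} \<rightarrow> S"
  proof
    fix i assume "i \<in> {..<N}"
    then have "b i \<in> (SIGMA A:S. {..<w A})" using b by (auto simp: bij_betw_def)
    then show "(fst \<circ> b) i \<in> S" by (cases "b i") auto
  qed
  ultimately show ?thesis by (intro exI[of _ "fst \<circ> b"]) auto
qed

text \<open>One generation of the matching. The elements of \<open>W\<close> are the cylinders owned by a node, the pairs
  \<open>(c, i)\<close> are their children, and \<open>S\<close> is the set of children of the node. Each child is placed in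
  a single bin \<open>c\<close>; the cylinders that it receives therefore have a common parent, as the last conjunct
  says.\<close>

lemma distribute_words:
  fixes w :: "'a \<Rightarrow> nat" and W :: "'b set"
  assumes "finite W" "finite S" "\<And>A. A \<in> S \<Longrightarrow> 1 \<le> w A \<and> w A \<le> M"
    and "sum w S = card W * N" "card W * M \<le> card {A\<in>S. w A = 1}" "M \<le> N"
  shows "\<exists>own. (\<forall>c\<in>W. \<forall>i<N. own c i \<in> S) \<and>
     (\<forall>A\<in>S. card {(c, i). c \<in> W \<and> i < N \<and> own c i = A} = w A) \<and>
     (\<forall>c\<in>W. \<forall>c'\<in>W. \<forall>i<N. \<forall>i'<N. own c i = own c' i' \<longrightarrow> c = c')"
proof -
  obtain bin where bin: "bin \<in> S \<rightarrow> W" "\<And>c. c \<in> W \<Longrightarrow> sum w {A\<in>S. bin A = c} = N"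
    using pack_bins[OF assms] by blast
  define Q where "Q c h \<longleftrightarrow> h \<in> {..<N} \<rightarrow> {A\<in>S. bin A = c} \<and>
      (\<forall>A\<in>{A\<in>S. bin A = c}. card {i. i < N \<and> h i = A} = w A)" for c and h :: "nat \<Rightarrow> 'a"
  have ex: "\<exists>h. Q c h" if "c \<in> W" for c
    unfolding Q_def using bin(2)[OF that] assms(2) by (intro distribute) auto
  define own where "own c = (SOME h. Q c h)" for c
  have Q: "Q c (own c)" if "c \<in> W" for c
    unfolding own_def using ex[OF that] by (rule someI_ex)
  have own: "own c \<in> {..<N} \<rightarrow> {A\<in>S. bin A = c}"
      "A \<in> S \<Longrightarrow> bin A = c \<Longrightarrow> card {i. i < N \<and> own c i = A} = w A" if "c \<in> W" for c A
    using Q[OF that] by (auto simp: Q_def)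
  have ob: "own c i \<in> S" "bin (own c i) = c" if "c \<in> W" "i < N" for c i
    using own(1)[OF that(1)] that(2) by auto
  have "card {(c, i). c \<in> W \<and> i < N \<and> own c i = A} = w A" if A: "A \<in> S" for A
  proof -
    have "bin A \<in> W" using bin(1) A by auto
    then have "{(c, i). c \<in> W \<and> i < N \<and> own c i = A} = {bin A} \<times> {i. i < N \<and> own (bin A) i = A}"
      using ob by auto
    then show ?thesis using own(2)[OF \<open>bin A \<in> W\<close> A] by (simp add: card_cartesian_product_singleton)
  qed
  moreover have "c = c'" if "c \<in> W" "c' \<in> W" "i < N" "i' < N" "own c i = own c' i'" for c c' i i'
    using ob(2)[OF that(1,3)] ob(2)[OF that(2,4)] that(5) by simp
  ultimately show ?thesis using ob(1) by (intro exI[of _ own]) blast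
qed


section \<open>Weighted trees and sequence spaces\<close>

text \<open>The finite words that name the cylinders of generation \<open>k\<close> in a sequence space with \<open>b i\<close>
  choices at position \<open>i\<close>.\<close>

definition words :: "(nat \<Rightarrow> nat) \<Rightarrow> nat \<Rightarrow> nat list set" where
  "words b k = {ws. length ws = k \<and> (\<forall>i<k. ws ! i < b i)}"

lemma words_0: "words b 0 = {[]}"
  by (auto simp: words_def)

lemma snoc_in_words: "ws @ [i] \<in> words b (Suc k) \<longleftrightarrow> ws \<in> words b k \<and> i < b k"
  by (auto simp: words_def nth_append less_Suc_eq)

lemma words_SucE:
  assumes "v \<in> words b (Suc k)"
  obtains ws i where "v = ws @ [i]" "ws \<in> words b k" "i < b k"
proof -
  have "v \<noteq> []" using assms by (auto simp: words_def)
  then have v: "v = butlast v @ [last v]" by simp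
  then have "butlast v \<in> words b k \<and> last v < b k" using assms snoc_in_words by metis
  then show thesis using that v by blast
qed

lemma finite_words: "finite (words b k)"
proof (induction k)
  case (Suc k)
  have "words b (Suc k) \<subseteq> (\<lambda>(ws, i). ws @ [i]) ` (words b k \<times> {..<b k})"
    by (auto elim!: words_SucE)
  then show ?case using Suc by (meson finite_SigmaI finite_imageI finite_lessThan finite_subset)
qed (simp add: words_0)

text \<open>The nodes of generation \<open>k\<close> are the values of \<open>I k\<close>, with weights \<open>w k\<close>; the points of the metric space are
  images of elements of \<open>X\<close>, possibly of several ones. By recursion on \<open>k\<close> every word of length
  \<open>k\<close> gets an owner such that each node owns as many words as its weight says, the owners
  of a word and of its extensions are compatible, and the words of a node of generation
  \<open>k + 1\<close> extend a single word of length \<open>k\<close>. A sequence determines a nested sequence of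
  owners and hence, by compactness, a point. Two sequences that first differ at position
  \<open>K\<close> have the same owner in generation \<open>K\<close>, but different owners in generation \<open>K + 2\<close>,
  because a common owner there would force equal prefixes of length \<open>K + 1\<close>. So the distance of
  their points is of the order \<open>\<xi> ^ K\<close>.\<close>

lemma lipschitz_equivalent_of_weighted_tree:
  fixes X :: "'x set" and \<pi> :: "'x \<Rightarrow> 'e::metric_space" and I :: "nat \<Rightarrow> 'x \<Rightarrow> 'l"
    and w :: "nat \<Rightarrow> 'l \<Rightarrow> nat" and b :: "nat \<Rightarrow> nat"
  assumes \<xi>: "0 < \<xi>" "\<xi> < 1" and "0 < c"
    and cpt: "compact (\<pi> ` X)"
    and refine: "\<And>k x y. x \<in> X \<Longrightarrow> y \<in> X \<Longrightarrow> I (Suc k) x = I (Suc k) y \<Longrightarrow> I k x = I k y"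
    and diam: "\<And>k x y. x \<in> X \<Longrightarrow> y \<in> X \<Longrightarrow> I k x = I k y \<Longrightarrow> dist (\<pi> x) (\<pi> y) \<le> C * \<xi> ^ k"
    and sep: "\<And>k x y. x \<in> X \<Longrightarrow> y \<in> X \<Longrightarrow> I k x \<noteq> I k y \<Longrightarrow> c * \<xi> ^ k \<le> dist (\<pi> x) (\<pi> y)"
    and fin: "\<And>k. finite (I k ` X)"
    and w: "\<And>k x. x \<in> X \<Longrightarrow> 1 \<le> w k (I k x) \<and> w k (I k x) \<le> M"
    and root: "sum (w 0) (I 0 ` X) = 1"
    and children: "\<And>k x. x \<in> X \<Longrightarrow>
      sum (w (Suc k)) (I (Suc k) ` {y\<in>X. I k y = I k x}) = w k (I k x) * b k"
    and ones: "\<And>k x. x \<in> X \<Longrightarrow> w k (I k x) * M \<le>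
      card {B \<in> I (Suc k) ` {y\<in>X. I k y = I k x}. w (Suc k) B = 1}"
    and q: "\<And>k. q (Suc k) = b k"
  shows "lipschitz_equivalent (\<pi> ` X) dist (seq_space q) (seq_dist \<xi>)"
proof -
  \<comment> \<open>\<open>Ch\<close>: children of a node; \<open>inv\<close>: each node owns the right number of words; \<open>ext\<close>: owners are compatible, and words with a common owner have a common parent.\<close>
  define Ch where "Ch k A = I (Suc k) ` {y\<in>X. I k y = A}" for k A
  define inv where "inv k f \<longleftrightarrow> (\<forall>ws\<in>words b k. f ws \<in> I k ` X) \<and>
      (\<forall>A\<in>I k ` X. card {ws\<in>words b k. f ws = A} = w k A)" for k f
  define ext where "ext k f f' \<longleftrightarrow>
      (\<forall>ws\<in>words b k. \<forall>i<b k. f' (ws @ [i]) \<in> Ch k (f ws)) \<and>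
      (\<forall>ws\<in>words b k. \<forall>ws'\<in>words b k. \<forall>i<b k. \<forall>i'<b k.
         f' (ws @ [i]) = f' (ws' @ [i']) \<longrightarrow> ws = ws')" for k and f f' :: "nat list \<Rightarrow> 'l"
  have finCh: "finite (Ch k A)" for k A
    unfolding Ch_def by (rule finite_subset[OF _ fin[of "Suc k"]]) auto
  have Ch_disj: "A = A'" if "B \<in> Ch k A" "B \<in> Ch k A'" for k A A' B
    using that refine unfolding Ch_def by auto
  have wCh: "1 \<le> w (Suc k) B \<and> w (Suc k) B \<le> M" if "B \<in> Ch k A" for k A B
    using that w unfolding Ch_def by auto
  \<comment> \<open>The children of weight one have a total weight of at least \<open>M\<close> times that of their parent.\<close>
  have Mb: "M \<le> b k" if "x \<in> X" for k x
  proof -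
    let ?S = "Ch k (I k x)" and ?O = "{B \<in> Ch k (I k x). w (Suc k) B = 1}"
    have "card ?O = sum (w (Suc k)) ?O" by simp
    also have "\<dots> \<le> sum (w (Suc k)) ?S" using finCh by (intro sum_mono2) auto
    finally have "w k (I k x) * M \<le> w k (I k x) * b k"
      using ones[OF that, of k] children[OF that, of k] unfolding Ch_def by linarith
    then show ?thesis using w[OF that, of k] by auto
  qed
  obtain A0 where A0: "I 0 ` X = {A0}" "w 0 A0 = 1"
    using sum_le_one_of_pos[OF fin root] w by auto
  have step: "\<exists>f'. inv (Suc k) f' \<and> ext k f f'" if f: "inv k f" for k f
  proof -
    define W where "W A = {ws\<in>words b k. f ws = A}" for A
    define P where "P A own \<longleftrightarrow> (\<forall>ws\<in>W A. \<forall>i<b k. own ws i \<in> Ch k A) \<and>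
       (\<forall>B\<in>Ch k A. card {(ws, i). ws \<in> W A \<and> i < b k \<and> own ws i = B} = w (Suc k) B) \<and>
       (\<forall>ws\<in>W A. \<forall>ws'\<in>W A. \<forall>i<b k. \<forall>i'<b k. own ws i = own ws' i' \<longrightarrow> ws = ws')"
      for A and own :: "nat list \<Rightarrow> nat \<Rightarrow> 'l"
    have "\<exists>own. P A own" if A: "A \<in> I k ` X" for A
    proof -
      obtain x where x: "x \<in> X" "A = I k x" using A by auto
      have cW: "card (W A) = w k A" using f A unfolding inv_def W_def by blast
      show ?thesis unfolding P_def
      proof (rule distribute_words)
        show "finite (W A)" unfolding W_def using finite_words by simp
        show "sum (w (Suc k)) (Ch k A) = card (W A) * b k"
          using children[OF x(1), of k] x(2) cW by (simp add: Ch_def)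
        show "card (W A) * M \<le> card {B \<in> Ch k A. w (Suc k) B = 1}"
          using ones[OF x(1), of k] x(2) cW by (simp add: Ch_def)
      qed (use finCh wCh Mb[OF x(1)] in auto)
    qed
    then have P: "P A (SOME own. P A own)" if "A \<in> I k ` X" for A
      using that by (simp add: someI_ex)
    define own where "own A = (SOME own. P A own)" for A
    have ownP: "P A (own A)" if "A \<in> I k ` X" for A using P[OF that] by (simp add: own_def)
    define f' where "f' v = own (f (butlast v)) (butlast v) (last v)" for v
    have f'_snoc: "f' (ws @ [i]) = own (f ws) ws i" for ws i by (simp add: f'_def)
    have fI: "f ws \<in> I k ` X" if "ws \<in> words b k" for ws using f that by (auto simp: inv_def)
    have inCh: "f' (ws @ [i]) \<in> Ch k (f ws)" if "ws \<in> words b k" "i < b k" for ws i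
      using ownP[OF fI[OF that(1)]] that unfolding f'_snoc P_def W_def by auto
    have "ws = ws'" if ws: "ws \<in> words b k" "ws' \<in> words b k" "i < b k" "i' < b k"
      and eq: "f' (ws @ [i]) = f' (ws' @ [i'])" for ws ws' i i'
    proof -
      have "f ws = f ws'" using inCh[OF ws(1,3)] inCh[OF ws(2,4)] eq Ch_disj by metis
      then show ?thesis
        using ownP[OF fI[OF ws(1)]] ws eq unfolding f'_snoc P_def W_def by auto
    qed
    then have "ext k f f'" using inCh unfolding ext_def by blast
    moreover have "inv (Suc k) f'" unfolding inv_def
    proof (intro conjI ballI)
      fix v assume "v \<in> words b (Suc k)"
      then obtain ws i where v: "v = ws @ [i]" "ws \<in> words b k" "i < b k" by (rule words_SucE)
      then show "f' v \<in> I (Suc k) ` X" using inCh[OF v(2,3)] by (auto simp: Ch_def)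
    next
      fix B assume "B \<in> I (Suc k) ` X"
      then obtain x where x: "x \<in> X" "B = I (Suc k) x" by auto
      define A where "A = I k x"
      have A: "A \<in> I k ` X" "B \<in> Ch k A" using x by (auto simp: A_def Ch_def)
      have "{v\<in>words b (Suc k). f' v = B} =
          (\<lambda>(ws, i). ws @ [i]) ` {(ws, i). ws \<in> W A \<and> i < b k \<and> own A ws i = B}"
      proof (intro set_eqI iffI)
        fix v assume "v \<in> {v\<in>words b (Suc k). f' v = B}"
        then obtain ws i where v: "v = ws @ [i]" "ws \<in> words b k" "i < b k" "f' v = B"
          by (auto elim: words_SucE)
        then have "f ws = A" using inCh[OF v(2,3)] A(2) Ch_disj by metis
        then show "v \<in> (\<lambda>(ws, i). ws @ [i]) ` {(ws, i). ws \<in> W A \<and> i < b k \<and> own A ws i = B}"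
          using v f'_snoc by (auto simp: W_def)
      next
        fix v assume "v \<in> (\<lambda>(ws, i). ws @ [i]) ` {(ws, i). ws \<in> W A \<and> i < b k \<and> own A ws i = B}"
        then show "v \<in> {v\<in>words b (Suc k). f' v = B}"
          by (auto simp: W_def f'_snoc snoc_in_words)
      qed
      moreover have "inj_on (\<lambda>(ws, i). ws @ [i]) Z" for Z :: "(nat list \<times> nat) set"
        by (auto simp: inj_on_def)
      ultimately show "card {v\<in>words b (Suc k). f' v = B} = w (Suc k) B"
        using ownP[OF A(1)] A(2) unfolding P_def by (simp add: card_image)
    qed
    ultimately show ?thesis by blast
  qed
  have init: "inv 0 (\<lambda>_. A0)"
    using A0 by (auto simp: inv_def words_0)
  obtain F where F: "\<And>k. inv k (F k)" "\<And>k. ext k (F k) (F (Suc k))"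
    using dependent_nat_choice[of inv ext] init step by blast
  define pre where "pre \<omega> k = map \<omega> [0..<k]" for \<omega> :: "nat \<Rightarrow> nat" and k
  have pre_Suc: "pre \<omega> (Suc k) = pre \<omega> k @ [\<omega> k]" for \<omega> k by (simp add: pre_def)
  have pre_words: "pre \<omega> k \<in> words b k" if "\<omega> \<in> seq_space q" for \<omega> k
    using that q by (auto simp: pre_def words_def seq_space_def)
  have \<omega>_less: "\<omega> k < b k" if "\<omega> \<in> seq_space q" for \<omega> k
    using that q by (auto simp: seq_space_def)
  define lab where "lab \<omega> k = F k (pre \<omega> k)" for \<omega> k
  have lab_Ch: "lab \<omega> (Suc k) \<in> Ch k (lab \<omega> k)" if "\<omega> \<in> seq_space q" for \<omega> k
    using F(2)[of k] pre_words[OF that] \<omega>_less[OF that] unfolding ext_def lab_def pre_Suc by blast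
  have ex_point: "\<exists>x. x \<in> X \<and> (\<forall>k. I k x = lab \<omega> k)" if \<omega>: "\<omega> \<in> seq_space q" for \<omega>
  proof -
    have "\<exists>x\<in>X. I k x = lab \<omega> k" for k
      using F(1)[of k] pre_words[OF \<omega>, of k] unfolding inv_def lab_def by fastforce
    then obtain xs where xs: "\<And>k. xs k \<in> X" "\<And>k. I k (xs k) = lab \<omega> k" by metis
    have nest: "I j x = lab \<omega> j" if "j \<le> k" "I k x = lab \<omega> k" and x: "x \<in> X" for j k x
      using that(1,2)
    proof (induction k rule: dec_induct)
      case (step k)
      obtain y where y: "y \<in> X" "I k y = lab \<omega> k" "I (Suc k) y = lab \<omega> (Suc k)"
        using lab_Ch[OF \<omega>, of k] by (auto simp: Ch_def)
      have "I k x = lab \<omega> k" using step.prems refine[OF x y(1), of k] y by simp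
      then show ?case by (rule step.IH)
    qed
    have "\<forall>k. (\<pi> \<circ> xs) k \<in> \<pi> ` X" using xs by auto
    then obtain z r where z: "z \<in> \<pi> ` X" "strict_mono r" "((\<pi> \<circ> xs) \<circ> r) \<longlonglongrightarrow> z"
      using cpt unfolding compact_def by blast
    obtain x where x: "x \<in> X" "z = \<pi> x" using z(1) by auto
    have "I j x = lab \<omega> j" for j
    proof -
      have "c * \<xi> ^ j > 0" using \<open>0 < c\<close> \<xi> by simp
      then have "eventually (\<lambda>k. dist (((\<pi> \<circ> xs) \<circ> r) k) z < c * \<xi> ^ j) sequentially"
        by (rule tendstoD[OF z(3)])
      then obtain k0 where "\<And>k. k \<ge> k0 \<Longrightarrow> dist (\<pi> (xs (r k))) (\<pi> x) < c * \<xi> ^ j"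
        unfolding eventually_sequentially x(2) by auto
      then have "dist (\<pi> (xs (r (max j k0)))) (\<pi> x) < c * \<xi> ^ j" by simp
      then have "I j (xs (r (max j k0))) = I j x" using sep[OF xs(1) x(1), of j] by force
      moreover have "j \<le> r (max j k0)"
        using seq_suble[OF z(2), of "max j k0"] by linarith
      ultimately show ?thesis using nest[OF _ xs(2) xs(1)] by metis
    qed
    then show ?thesis using x by blast
  qed
  define h where "h \<omega> = (SOME x. x \<in> X \<and> (\<forall>k. I k x = lab \<omega> k))" for \<omega>
  have h: "h \<omega> \<in> X" "I k (h \<omega>) = lab \<omega> k" if "\<omega> \<in> seq_space q" for \<omega> k
    using someI_ex[OF ex_point[OF that]] unfolding h_def by auto
  define g where "g \<omega> = \<pi> (h \<omega>)" for \<omega>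
  have bounds: "c * \<xi>\<^sup>2 * seq_dist \<xi> \<omega> \<omega>' \<le> dist (g \<omega>) (g \<omega>') \<and> dist (g \<omega>) (g \<omega>') \<le> C * seq_dist \<xi> \<omega> \<omega>'"
    if \<omega>: "\<omega> \<in> seq_space q" and \<omega>': "\<omega>' \<in> seq_space q" for \<omega> \<omega>'
  proof (cases "\<omega> = \<omega>'")
    case False
    then obtain K where K: "\<And>i. i < K \<Longrightarrow> \<omega> i = \<omega>' i" "\<omega> K \<noteq> \<omega>' K" "seq_dist \<xi> \<omega> \<omega>' = \<xi> ^ K"
      by (rule seq_dist_cases) blast
    have "pre \<omega> K = pre \<omega>' K" using K(1) by (auto simp: pre_def)
    then have "I K (h \<omega>) = I K (h \<omega>')" using h \<omega> \<omega>' by (simp add: lab_def)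
    then have "dist (g \<omega>) (g \<omega>') \<le> C * \<xi> ^ K" using diam h \<omega> \<omega>' by (simp add: g_def)
    moreover have "lab \<omega> (Suc (Suc K)) \<noteq> lab \<omega>' (Suc (Suc K))"
    proof
      assume "lab \<omega> (Suc (Suc K)) = lab \<omega>' (Suc (Suc K))"
      then have "pre \<omega> (Suc K) = pre \<omega>' (Suc K)"
        using F(2)[of "Suc K"] pre_words[OF \<omega>, of "Suc K"] pre_words[OF \<omega>', of "Suc K"]
          \<omega>_less[OF \<omega>] \<omega>_less[OF \<omega>'] 
        unfolding ext_def lab_def pre_Suc[of _ "Suc K"] by blast
      then show False using K(2) by (simp add: pre_Suc)
    qed
    then have "c * \<xi> ^ Suc (Suc K) \<le> dist (g \<omega>) (g \<omega>')"
      using h[OF \<omega>] h[OF \<omega>'] sep unfolding g_def by metis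
    ultimately show ?thesis unfolding K(3) by (simp add: power2_eq_square mult.assoc)
  qed (simp add: seq_dist_def)
  have c\<xi>: "c * \<xi>\<^sup>2 > 0" using \<open>0 < c\<close> \<xi> by simp
  have "inj_on g (seq_space q)"
  proof (rule inj_onI, rule ccontr)
    fix \<omega> \<omega>' assume a: "\<omega> \<in> seq_space q" "\<omega>' \<in> seq_space q" "g \<omega> = g \<omega>'" "\<omega> \<noteq> \<omega>'"
    have "seq_dist \<xi> \<omega> \<omega>' > 0" using a(4) \<xi> by (simp add: seq_dist_def)
    then have "c * \<xi>\<^sup>2 * seq_dist \<xi> \<omega> \<omega>' > 0" using c\<xi> by (rule mult_pos_pos[rotated])
    then show False using bounds[OF a(1,2)] a(3) by simp
  qed
  moreover have "g ` seq_space q = \<pi> ` X"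
  proof (intro equalityI subsetI)
    fix z assume "z \<in> \<pi> ` X"
    then obtain x where x: "x \<in> X" "z = \<pi> x" by auto
    have "\<exists>ws. ws \<in> words b k \<and> F k ws = I k x" for k
    proof -
      have "card {ws\<in>words b k. F k ws = I k x} = w k (I k x)"
        using F(1)[of k] x(1) unfolding inv_def by auto
      then have "{ws\<in>words b k. F k ws = I k x} \<noteq> {}" using w[OF x(1), of k] by fastforce
      then show ?thesis by blast
    qed
    then obtain p where p: "\<And>k. p k \<in> words b k" "\<And>k. F k (p k) = I k x" by metis
    have "\<exists>ws i. p (Suc k) = ws @ [i] \<and> ws \<in> words b k \<and> i < b k" for k
      using p(1)[of "Suc k"] by (blast elim: words_SucE)
    then obtain u e where pu: "\<And>k. p (Suc k) = u k @ [e k]"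
      and uw: "\<And>k. u k \<in> words b k" "\<And>k. e k < b k" by metis
    \<comment> \<open>The word \<open>u k\<close> is the common parent of all words owned by the node of \<open>x\<close> in generation \<open>k + 1\<close>.\<close>
    have uI: "F k (u k) = I k x" for k
    proof -
      have "I (Suc k) x \<in> Ch k (F k (u k))"
        using F(2)[of k] uw(1)[of k] uw(2)[of k] p(2)[of "Suc k"] unfolding ext_def pu by force
      then show ?thesis using refine[OF x(1), of _ k] by (auto simp: Ch_def)
    qed
    have u_Suc: "\<exists>i<b k. u (Suc k) = u k @ [i]" for k
    proof -
      obtain ws i where ws: "u (Suc k) = ws @ [i]" "ws \<in> words b k" "i < b k"
        using uw(1)[of "Suc k"] by (rule words_SucE)
      have "F (Suc k) (ws @ [i]) = F (Suc k) (u k @ [e k])"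
        using uI[of "Suc k"] p(2)[of "Suc k"] ws(1) pu[of k] by simp
      then have "ws = u k" using F(2)[of k] ws(2,3) uw(1)[of k] uw(2)[of k] unfolding ext_def by blast
      then show ?thesis using ws by auto
    qed
    then obtain \<omega> where \<omega>: "\<And>k. \<omega> k < b k" "\<And>k. u (Suc k) = u k @ [\<omega> k]" by metis
    have \<omega>q: "\<omega> \<in> seq_space q" using \<omega>(1) q by (simp add: seq_space_def)
    have "u 0 = []" using uw(1)[of 0] by (simp add: words_0)
    then have "pre \<omega> k = u k" for k
      by (induction k) (auto simp: \<omega>(2) pre_Suc, simp add: pre_def)
    then have "I k (h \<omega>) = I k x" for k using h(2)[OF \<omega>q] uI by (simp add: lab_def)
    then have "dist (g \<omega>) z \<le> C * \<xi> ^ k" for k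
      using diam[OF h(1)[OF \<omega>q] x(1)] by (simp add: g_def x(2))
    moreover have "(\<lambda>k. C * \<xi> ^ k) \<longlonglongrightarrow> C * 0"
      using \<xi> by (intro tendsto_mult tendsto_const LIMSEQ_realpow_zero) auto
    ultimately have "dist (g \<omega>) z \<le> C * 0" by (intro LIMSEQ_le_const) auto
    then show "z \<in> g ` seq_space q" using \<omega>q by auto
  qed (use h(1) in \<open>auto simp: g_def\<close>)
  ultimately have bij: "bij_betw g (seq_space q) (\<pi> ` X)" by (simp add: bij_betw_def)
  define L where "L = max C (inverse (c * \<xi>\<^sup>2))"
  have L: "C \<le> L" "inverse L \<le> c * \<xi>\<^sup>2" "L > 0"
  proof -
    have i: "inverse (c * \<xi>\<^sup>2) \<le> L" "C \<le> L" by (simp_all only: L_def max.cobounded1 max.cobounded2)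
    have i': "0 < inverse (c * \<xi>\<^sup>2)" using c\<xi> by (rule positive_imp_inverse_positive)
    show "inverse L \<le> c * \<xi>\<^sup>2" using le_imp_inverse_le[OF i(1) i'] by simp
    show "C \<le> L" "L > 0" using i i' by linarith+
  qed
  have "inverse L * seq_dist \<xi> \<omega> \<omega>' \<le> dist (g \<omega>) (g \<omega>') \<and> dist (g \<omega>) (g \<omega>') \<le> L * seq_dist \<xi> \<omega> \<omega>'"
    if "\<omega> \<in> seq_space q" "\<omega>' \<in> seq_space q" for \<omega> \<omega>'
  proof -
    have d: "seq_dist \<xi> \<omega> \<omega>' \<ge> 0" using \<xi> by (simp add: seq_dist_def)
    show ?thesis
      using bounds[OF that] mult_right_mono[OF L(1) d] mult_right_mono[OF L(2) d] by linarith
  qed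
  then have "lipschitz_equivalent (seq_space q) (seq_dist \<xi>) (\<pi> ` X) dist"
    unfolding lipschitz_equivalent_def using bij L(3) by blast
  then show ?thesis by (rule lipschitz_equivalent_sym)
qed


section \<open>Coding the points of a carpet\<close>

primrec radix :: "nat \<Rightarrow> (nat \<Rightarrow> nat) \<Rightarrow> nat \<Rightarrow> nat" where
  "radix b f 0 = 0"
| "radix b f (Suc k) = radix b f k * b + f k"

lemma radix_cong: "(\<And>t. t < k \<Longrightarrow> f t = g t) \<Longrightarrow> radix b f k = radix b g k"
  by (induction k) auto

lemma radix_less:
  assumes "\<And>t. f t < b"
  shows "radix b f k < b ^ k"
proof (induction k)
  case (Suc k)
  have "radix b f k * b + f k < radix b f k * b + b" using assms by simp
  also have "\<dots> = (radix b f k + 1) * b" by simp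
  also have "\<dots> \<le> b ^ k * b" using Suc by (intro mult_right_mono) auto
  finally show ?case by (simp add: mult.commute)
qed simp

lemma radix_Suc_div:
  assumes "f k < b"
  shows "radix b f (Suc k) div b = radix b f k" "radix b f (Suc k) mod b = f k"
  using assms by auto

lemma radix_eq_iff:
  assumes "\<And>t. f t < b" "\<And>t. g t < b"
  shows "radix b f k = radix b g k \<longleftrightarrow> (\<forall>t<k. f t = g t)"
proof (induction k)
  case (Suc k)
  have "radix b f (Suc k) = radix b g (Suc k) \<longleftrightarrow> radix b f k = radix b g k \<and> f k = g k"
    using radix_Suc_div[of f k b] radix_Suc_div[of g k b] assms by (metis radix.simps(2))
  then show ?case unfolding Suc.IH by (auto simp: less_Suc_eq)
qed simp

lemma radix_div:
  assumes "\<And>t. f t < b"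
  shows "radix b f (k + t) div b ^ t = radix b f k"
proof (induction t)
  case (Suc t)
  have "radix b f (k + Suc t) div b ^ Suc t = radix b f (Suc (k + t)) div b div b ^ t"
    by (simp add: div_mult2_eq)
  then show ?case using Suc radix_Suc_div(1)[of f "k + t" b, OF assms] by (simp del: radix.simps)
qed simp

locale carpet_coding =
  fixes n m :: nat and D :: "(nat \<times> nat) set"
  assumes m2: "2 \<le> m" and mn: "m < n" and D_sub: "D \<subseteq> {0..<n} \<times> {0..<m}" and D_card: "card D > 1"
begin

abbreviation "E \<equiv> carpet n m D"

lemma finite_D: "finite D" using D_card by (metis card.infinite not_less_zero)
lemma D_nonempty: "D \<noteq> {}" using D_card by auto
lemma digit_less: "d \<in> D \<Longrightarrow> fst d < n" "d \<in> D \<Longrightarrow> snd d < m"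
  using subsetD[OF D_sub, of d] by (simp_all add: mem_Times_iff)
lemma n2: "2 < n" using m2 mn by simp

lemma attractor: "E \<noteq> {}" "compact E" "E = (\<Union>d\<in>D. digit_map n m d ` E)"
proof -
  have "is_attractor n m D E"
    using m2 n2 finite_D D_nonempty by (intro carpet_is_attractor) auto
  then show "E \<noteq> {}" "compact E" "E = (\<Union>d\<in>D. digit_map n m d ` E)"
    unfolding is_attractor_def by blast+
qed

lemma digit_map_in_E: "d \<in> D \<Longrightarrow> z \<in> E \<Longrightarrow> digit_map n m d z \<in> E"
  using attractor(3) by blast

lemma E_digitE:
  assumes "z \<in> E"
  obtains d z' where "d \<in> D" "z' \<in> E" "z = digit_map n m d z'"
  using assms attractor(3) by blast

text \<open>Evaluate the recursion at points where \<open>f\<close> is maximal and minimal. It is used for both coordinates,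
  with \<open>b\<close> the respective base.\<close>

lemma coordinate_bounds:
  fixes f :: "real \<times> real \<Rightarrow> real"
  assumes "2 \<le> b" and cont: "continuous_on E f" and
    rec: "\<And>z. z \<in> E \<Longrightarrow> \<exists>i<b. \<exists>z'\<in>E. f z = (f z' + real i) / real b"
    and z: "z \<in> E"
  shows "0 \<le> f z \<and> f z \<le> 1"
proof -
  obtain p where p: "p \<in> E" "\<And>y. y \<in> E \<Longrightarrow> f y \<le> f p"
    using continuous_attains_sup[OF attractor(2,1) cont] by blast
  obtain q where q: "q \<in> E" "\<And>y. y \<in> E \<Longrightarrow> f q \<le> f y"
    using continuous_attains_inf[OF attractor(2,1) cont] by blast
  obtain i p' where i: "i < b" "p' \<in> E" "f p = (f p' + real i) / real b" using rec[OF p(1)] by blast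
  obtain j q' where j: "j < b" "q' \<in> E" "f q = (f q' + real j) / real b" using rec[OF q(1)] by blast
  have "f p * real b = f p' + real i" "real i \<le> real b - 1" using i assms(1) by auto
  then have "f p * real b \<le> f p + (real b - 1)" using p(2)[OF i(2)] by linarith
  then have "(f p - 1) * (real b - 1) \<le> 0" by (simp add: algebra_simps)
  then have "f p \<le> 1" using assms(1) by (simp add: mult_le_0_iff)
  moreover have "f q * real b = f q' + real j" using j assms(1) by auto
  then have "f q * real b \<ge> f q" using q(2)[OF j(2)] by linarith
  then have "0 \<le> f q * (real b - 1)" by (simp add: algebra_simps)
  then have "0 \<le> f q" using assms(1) by (simp add: zero_le_mult_iff)
  ultimately show ?thesis using p(2)[OF z] q(2)[OF z] by linarith
qed

lemma E_in_unit_square: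
  assumes "z \<in> E"
  shows "0 \<le> fst z \<and> fst z \<le> 1" "0 \<le> snd z \<and> snd z \<le> 1"
proof -
  have 1: "\<exists>i<n. \<exists>z'\<in>E. fst z = (fst z' + real i) / real n"
    and 2: "\<exists>i<m. \<exists>z'\<in>E. snd z = (snd z' + real i) / real m" if z: "z \<in> E" for z
  proof -
    obtain d z' where d: "d \<in> D" "z' \<in> E" "z = digit_map n m d z'" using z by (rule E_digitE)
    have "fst z = (fst z' + real (fst d)) / real n" "snd z = (snd z' + real (snd d)) / real m"
      by (simp_all add: d(3) digit_map_def)
    then show "\<exists>i<n. \<exists>z'\<in>E. fst z = (fst z' + real i) / real n"
      "\<exists>i<m. \<exists>z'\<in>E. snd z = (snd z' + real i) / real m"
      using d(2) digit_less[OF d(1)] by blast+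
  qed
  show "0 \<le> fst z \<and> fst z \<le> 1"
    using n2 by (intro coordinate_bounds[OF _ _ 1 assms] continuous_intros) auto
  show "0 \<le> snd z \<and> snd z \<le> 1"
    using m2 by (intro coordinate_bounds[OF _ _ 2 assms] continuous_intros) auto
qed

definition codes :: "(nat \<Rightarrow> nat \<times> nat) set" where
  "codes = {x. \<forall>t. x t \<in> D}"

definition col :: "(nat \<Rightarrow> nat \<times> nat) \<Rightarrow> nat \<Rightarrow> nat" where
  "col x k = radix n (\<lambda>t. fst (x t)) k"

definition row :: "(nat \<Rightarrow> nat \<times> nat) \<Rightarrow> nat \<Rightarrow> nat" where
  "row x l = radix m (\<lambda>t. snd (x t)) l"

lemma codesD: "x \<in> codes \<Longrightarrow> x t \<in> D" by (simp add: codes_def)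

lemma code_digit_less: "x \<in> codes \<Longrightarrow> fst (x t) < n" "x \<in> codes \<Longrightarrow> snd (x t) < m"
  using digit_less codesD by blast+

lemma col_simps [simp]: "col x 0 = 0" "col x (Suc k) = col x k * n + fst (x k)"
  and row_simps [simp]: "row x 0 = 0" "row x (Suc k) = row x k * m + snd (x k)"
  by (simp_all add: col_def row_def)

text \<open>For every \<open>k\<close>, the point lies in the closed rectangle given by the first \<open>k\<close> digits. A point
  on the boundary of rectangles may have several codes.\<close>

definition coded_by :: "(nat \<Rightarrow> nat \<times> nat) \<Rightarrow> real \<times> real \<Rightarrow> bool" where
  "coded_by x z \<longleftrightarrow> (\<forall>k. real (col x k) \<le> fst z * real n ^ k \<and> fst z * real n ^ k \<le> real (col x k) + 1 \<and>
     real (row x k) \<le> snd z * real m ^ k \<and> snd z * real m ^ k \<le> real (row x k) + 1)"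

lemma coded_by_orbit:
  assumes "\<And>t. z t = digit_map n m (x t) (z (Suc t))"
    and "\<And>t. 0 \<le> fst (z t) \<and> fst (z t) \<le> 1 \<and> 0 \<le> snd (z t) \<and> snd (z t) \<le> 1"
  shows "coded_by x (z 0)"
proof -
  have "fst (z 0) * real n ^ k = real (col x k) + fst (z k)" for k
  proof (induction k)
    case (Suc k)
    have "fst (z k) * real n = fst (z (Suc k)) + real (fst (x k))"
      using n2 by (subst assms(1)) (simp add: digit_map_def)
    moreover have "fst (z 0) * real n ^ Suc k = (fst (z 0) * real n ^ k) * real n" by simp
    ultimately show ?case unfolding Suc.IH by (simp add: algebra_simps)
  qed simp
  moreover have "snd (z 0) * real m ^ k = real (row x k) + snd (z k)" for k
  proof (induction k)
    case (Suc k)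
    have "snd (z k) * real m = snd (z (Suc k)) + real (snd (x k))"
      using m2 by (subst assms(1)) (simp add: digit_map_def)
    moreover have "snd (z 0) * real m ^ Suc k = (snd (z 0) * real m ^ k) * real m" by simp
    ultimately show ?case unfolding Suc.IH by (simp add: algebra_simps)
  qed simp
  ultimately show ?thesis using assms(2) by (simp add: coded_by_def)
qed

lemma eq_if_scaled_close:
  fixes s t b :: real
  assumes "1 < b" "\<And>k. \<bar>s - t\<bar> * b ^ k \<le> 1"
  shows "s = t"
proof (rule ccontr)
  assume "s \<noteq> t"
  then have "\<bar>s - t\<bar> > 0" by simp
  moreover obtain k where "inverse \<bar>s - t\<bar> < b ^ k" using real_arch_pow[OF assms(1)] by blast
  ultimately have "1 < \<bar>s - t\<bar> * b ^ k" by (simp add: field_simps)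
  then show False using assms(2)[of k] by simp
qed

lemma coded_by_unique:
  assumes "coded_by x z" "coded_by x z'"
  shows "z = z'"
proof (rule prod_eqI)
  have "\<bar>fst z - fst z'\<bar> * real n ^ k \<le> 1" for k
  proof -
    have "\<bar>fst z * real n ^ k - fst z' * real n ^ k\<bar> \<le> 1"
      using assms[unfolded coded_by_def, rule_format, of k] by linarith
    then show ?thesis by (simp add: left_diff_distrib[symmetric] abs_mult)
  qed
  then show "fst z = fst z'" using n2 by (intro eq_if_scaled_close[of "real n"]) auto
  have "\<bar>snd z - snd z'\<bar> * real m ^ k \<le> 1" for k
  proof -
    have "\<bar>snd z * real m ^ k - snd z' * real m ^ k\<bar> \<le> 1"
      using assms[unfolded coded_by_def, rule_format, of k] by linarith
    then show ?thesis by (simp add: left_diff_distrib[symmetric] abs_mult)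
  qed
  then show "snd z = snd z'" using m2 by (intro eq_if_scaled_close[of "real m"]) auto
qed

lemma ex_code:
  assumes "z \<in> E"
  shows "\<exists>x\<in>codes. coded_by x z"
proof -
  have "\<forall>y\<in>E. \<exists>p. fst p \<in> D \<and> snd p \<in> E \<and> y = digit_map n m (fst p) (snd p)"
  proof
    fix y assume "y \<in> E"
    then obtain d z' where "d \<in> D" "z' \<in> E" "y = digit_map n m d z'" by (rule E_digitE)
    then show "\<exists>p. fst p \<in> D \<and> snd p \<in> E \<and> y = digit_map n m (fst p) (snd p)"
      by (intro exI[of _ "(d, z')"]) simp
  qed
  then obtain p where p: "\<And>y. y \<in> E \<Longrightarrow> fst (p y) \<in> D \<and> snd (p y) \<in> E \<and> y = digit_map n m (fst (p y)) (snd (p y))"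
    by metis
  define zs where "zs t = ((\<lambda>y. snd (p y)) ^^ t) z" for t
  have zE: "zs t \<in> E" for t by (induction t) (use assms p in \<open>auto simp: zs_def\<close>)
  have "coded_by (\<lambda>t. fst (p (zs t))) (zs 0)"
  proof (rule coded_by_orbit)
    show "zs t = digit_map n m (fst (p (zs t))) (zs (Suc t))" for t
      using p[OF zE[of t]] by (simp add: zs_def)
  qed (use E_in_unit_square[OF zE] in auto)
  moreover have "(\<lambda>t. fst (p (zs t))) \<in> codes" using p[OF zE] by (simp add: codes_def)
  ultimately show ?thesis by (auto simp: zs_def)
qed

text \<open>The images of \<open>E\<close> under the compositions of the first \<open>k\<close> digit maps are a decreasing sequence of nonempty
  compact sets.\<close>

lemma ex_coded_point:
  assumes "x \<in> codes"
  shows "\<exists>z\<in>E. coded_by x z"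
proof -
  define f where "f = rec_nat id (\<lambda>k g. g \<circ> digit_map n m (x k))"
  have f: "f 0 = id" "\<And>k. f (Suc k) = f k \<circ> digit_map n m (x k)" by (auto simp: f_def)
  have cont: "continuous_on S (f k)" for k S
  proof (induction k arbitrary: S)
    case 0
    then show ?case unfolding f by (rule continuous_on_id')
  next
    case (Suc k)
    show ?case unfolding f by (rule continuous_on_compose[OF continuous_on_digit_map Suc])
  qed
  have val: "fst (f k y) * real n ^ k = real (col x k) + fst y \<and>
      snd (f k y) * real m ^ k = real (row x k) + snd y" for k y
  proof (induction k arbitrary: y)
    case (Suc k)
    have *: "c * b ^ Suc k = (c * b ^ k) * b" for c b :: real by simp
    show ?case unfolding * f comp_apply using Suc[of "digit_map n m (x k) y"] n2 m2
      by (simp add: digit_map_def distrib_right[of _ _ "real n"] distrib_right[of _ _ "real m"]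
          add_divide_distrib)
  qed (simp add: f)
  have dec: "f (Suc k) ` E \<subseteq> f k ` E" for k
    using digit_map_in_E[OF codesD[OF assms]] by (auto simp: f)
  have "(\<Inter>k. f k ` E) \<noteq> {}"
  proof (rule compact_nest)
    show "compact (f k ` E)" for k using cont attractor(2) by (rule compact_continuous_image)
    show "f k ` E \<noteq> {}" for k using attractor(1) by simp
    show "f l ` E \<subseteq> f k ` E" if "k \<le> l" for k l
      using lift_Suc_antimono_le[of "\<lambda>k. f k ` E", OF dec that] .
  qed
  then obtain z where z: "\<And>k. z \<in> f k ` E" by blast
  have "coded_by x z" unfolding coded_by_def
  proof
    fix k
    obtain y where y: "y \<in> E" "z = f k y" using z[of k] by auto
    show "real (col x k) \<le> fst z * real n ^ k \<and> fst z * real n ^ k \<le> real (col x k) + 1 \<and>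
     real (row x k) \<le> snd z * real m ^ k \<and> snd z * real m ^ k \<le> real (row x k) + 1"
      using val[of k y] E_in_unit_square[OF y(1)] unfolding y(2) by simp
  qed
  moreover have "z \<in> E" using z[of 0] by (simp add: f)
  ultimately show ?thesis by blast
qed

definition pt :: "(nat \<Rightarrow> nat \<times> nat) \<Rightarrow> real \<times> real" where
  "pt x = (THE z. coded_by x z)"

lemma pt_coded: "x \<in> codes \<Longrightarrow> coded_by x (pt x)"
  unfolding pt_def using ex_coded_point coded_by_unique by (metis theI)

lemma pt_eq: "coded_by x z \<Longrightarrow> pt x = z"
  unfolding pt_def using coded_by_unique by blast

lemma pt_image: "pt ` codes = E"
proof
  show "pt ` codes \<subseteq> E" using ex_coded_point pt_eq by fastforce
  show "E \<subseteq> pt ` codes" using ex_code pt_eq by (metis imageI subsetI)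
qed

text \<open>If row \<open>j\<close> is full, every expansion in base \<open>n\<close> can be combined with the constant row digit \<open>j\<close>, so
  the horizontal segment at the height \<open>j / (m - 1)\<close>, whose expansion in base \<open>m\<close> is constant,
  lies in the carpet.\<close>

lemma not_totally_disconnected_if_full_row:
  assumes "\<And>i. i < n \<Longrightarrow> (i, j) \<in> D"
  shows "\<not> totally_disconnected E"
proof
  assume td: "totally_disconnected E"
  define y where "y = real j / (real m - 1)"
  have j: "j < m" using assms[of 0] n2 digit_less(2)[of "(0, j)"] by simp
  have y: "0 \<le> y" "y \<le> 1" "(y + real j) / real m = y"
    using j m2 by (auto simp: y_def field_simps)
  define dg where "dg t = min (n - 1) (nat \<lfloor>t * real n\<rfloor>)" for t :: real
  define nx where "nx t = t * real n - real (dg t)" for t :: real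
  have dg: "dg t < n" for t using n2 by (simp add: dg_def)
  have nx: "0 \<le> nx t \<and> nx t \<le> 1" if "0 \<le> t" "t \<le> 1" for t
  proof (cases "nat \<lfloor>t * real n\<rfloor> \<le> n - 1")
    case True
    then have "dg t = nat \<lfloor>t * real n\<rfloor>" by (simp add: dg_def)
    then have "real (dg t) = of_int \<lfloor>t * real n\<rfloor>" using that by simp
    then show ?thesis unfolding nx_def by linarith
  next
    case False
    then have "dg t = n - 1" by (simp add: dg_def)
    moreover have "n \<le> nat \<lfloor>t * real n\<rfloor>" using False by simp
    then have "real n \<le> t * real n" using that n2 by (simp add: le_nat_iff le_floor_iff)
    moreover have "t * real n \<le> real n" using that n2 by simp
    ultimately show ?thesis using n2 by (simp add: nx_def of_nat_diff)
  qed
  have mem: "(t, y) \<in> E" if t: "0 \<le> t" "t \<le> 1" for t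
  proof -
    define ts where "ts k = (nx ^^ k) t" for k
    have ts: "0 \<le> ts k \<and> ts k \<le> 1" for k
      by (induction k) (use t nx in \<open>auto simp: ts_def\<close>)
    define x where "x k = (dg (ts k), j)" for k
    have "coded_by x ((\<lambda>k. (ts k, y)) 0)"
    proof (rule coded_by_orbit)
      show "(ts k, y) = digit_map n m (x k) (ts (Suc k), y)" for k
        using y(3) n2 by (simp add: digit_map_def x_def ts_def nx_def)
    qed (use ts y in auto)
    moreover have "x \<in> codes" using assms dg by (simp add: x_def codes_def)
    ultimately have "(ts 0, y) \<in> pt ` codes" using pt_eq by (metis imageI)
    then show ?thesis by (simp add: pt_image ts_def)
  qed
  have "connected ({0..1::real} \<times> {y})" by (intro connected_Times) auto
  moreover have "{0..1} \<times> {y} \<subseteq> E" using mem by auto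
  ultimately have "connected_component E (0, y) (1, y)"
    unfolding connected_component_def by (intro exI[of _ "{0..1} \<times> {y}"]) auto
  moreover have "connected_component_set E (0, y) = {(0, y)}"
    using td mem[of 0] by (simp add: totally_disconnected_def)
  ultimately show False by auto
qed

end


section \<open>Generations of approximate squares\<close>

context carpet_coding
begin

lemma sigma_pos: "0 < sigma_nm n m" and sigma_less_1: "sigma_nm n m < 1"
proof -
  have "0 < ln (real m)" "ln (real m) < ln (real n)" using m2 mn by auto
  then show "0 < sigma_nm n m" "sigma_nm n m < 1" by (auto simp: sigma_nm_def)
qed

lemma power_le_power_iff: "m ^ l \<le> n ^ k \<longleftrightarrow> real l \<le> real k / sigma_nm n m"
proof -
  have pos: "0 < ln (real m)" "0 < ln (real n)" using m2 mn by auto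
  have "m ^ l \<le> n ^ k \<longleftrightarrow> real m ^ l \<le> real n ^ k"
    by (metis of_nat_le_iff of_nat_power)
  also have "\<dots> \<longleftrightarrow> ln (real m ^ l) \<le> ln (real n ^ k)"
    using m2 n2 by (intro ln_le_cancel_iff[symmetric]) auto
  also have "\<dots> \<longleftrightarrow> real l * ln (real m) \<le> real k * ln (real n)"
    using m2 n2 by (simp add: ln_realpow)
  also have "\<dots> \<longleftrightarrow> real l \<le> real k / sigma_nm n m"
    using pos by (simp add: sigma_nm_def field_simps)
  finally show ?thesis .
qed

text \<open>The number of row digits of a square of generation \<open>k\<close>; it is the largest \<open>l\<close> with
  \<open>m ^ l \<le> n ^ k\<close>, see \<open>le_L_iff\<close>.\<close>

definition L :: "nat \<Rightarrow> nat" where "L k = nat \<lfloor>real k / sigma_nm n m\<rfloor>"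

lemma le_L_iff: "l \<le> L k \<longleftrightarrow> m ^ l \<le> n ^ k"
proof -
  have "0 \<le> real k / sigma_nm n m" using sigma_pos by simp
  then show ?thesis unfolding power_le_power_iff L_def by (simp add: le_nat_iff le_floor_iff)
qed

lemma L_bounds: "m ^ L k \<le> n ^ k" "n ^ k < m ^ Suc (L k)"
  using le_L_iff[of "L k" k] le_L_iff[of "Suc (L k)" k] by auto

lemma L_Suc: "Suc (L k) \<le> L (Suc k)"
  unfolding le_L_iff using mult_mono[of m n "m ^ L k" "n ^ k"] L_bounds(1)[of k] mn by simp

lemma L_add: "L k + t \<le> L (k + t)"
  by (induction t) (use L_Suc in \<open>auto intro: order_trans[OF _ L_Suc]\<close>)

lemma L_mono: "k \<le> k' \<Longrightarrow> L k \<le> L k'"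
  using L_add[of k "k' - k"] by simp

lemma L_0 [simp]: "L 0 = 0" by (simp add: L_def)

lemma le_L: "k \<le> L k" using L_add[of 0 k] by simp

text \<open>This is where \<open>m < n\<close> enters quantitatively: the row digits known in generation \<open>k\<close> run ahead of the column
  digits by any given amount. The amount \<open>4\<close> is what \<open>ex_split_below\<close> needs.\<close>

lemma eventually_L_far: "\<exists>k0. \<forall>k\<ge>k0. k + 4 \<le> L k"
proof -
  define \<epsilon> where "\<epsilon> = 1 / sigma_nm n m - 1"
  have \<epsilon>: "\<epsilon> > 0" using sigma_pos sigma_less_1 by (simp add: \<epsilon>_def)
  obtain k0 where k0: "4 / \<epsilon> < real k0" using reals_Archimedean2 by blast
  have "k + 4 \<le> L k" if "k \<ge> k0" for k
  proof -
    have "4 / \<epsilon> \<le> real k" using k0 that by simp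
    then have "4 \<le> real k * \<epsilon>" using \<epsilon> by (simp add: divide_le_eq)
    then have "real (k + 4) \<le> real k / sigma_nm n m" by (simp add: \<epsilon>_def algebra_simps)
    then show ?thesis unfolding le_L_iff power_le_power_iff .
  qed
  then show ?thesis by blast
qed

end


section \<open>Counting approximate squares\<close>

lemma card_by_fibers:
  assumes "finite A" "\<And>x. x \<in> A \<Longrightarrow> card {y\<in>A. f y = f x} = c"
  shows "card A = card (f ` A) * c"
proof -
  have "card A = (\<Sum>p\<in>f ` A. card {y\<in>A. f y = p})"
    using sum.image_gen[OF assms(1), of "\<lambda>_. 1::nat" f] by simp
  also have "\<dots> = (\<Sum>p\<in>f ` A. c)" using assms(2) by (intro sum.cong) auto
  finally show ?thesis by simp
qed

lemma card_le_fibers: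
  assumes "finite A" "\<And>x. x \<in> A \<Longrightarrow> card {y\<in>A. f y = f x} \<le> c"
  shows "card A \<le> card (f ` A) * c"
proof -
  have "card A = (\<Sum>p\<in>f ` A. card {y\<in>A. f y = p})"
    using sum.image_gen[OF assms(1), of "\<lambda>_. 1::nat" f] by simp
  also have "\<dots> \<le> (\<Sum>p\<in>f ` A. c)" using assms(2) by (intro sum_mono) auto
  finally show ?thesis by simp
qed

text \<open>Two closed grid rectangles with these integer coordinates intersect.\<close>

definition near :: "nat \<times> nat \<Rightarrow> nat \<times> nat \<Rightarrow> bool" where
  "near p p' \<longleftrightarrow> fst p \<le> fst p' + 1 \<and> fst p' \<le> fst p + 1 \<and> snd p \<le> snd p' + 1 \<and> snd p' \<le> snd p + 1"

lemma div_le_div_plus_1: "a div c \<le> b div c + 1" if "a \<le> b + 1" for a b c :: nat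
proof (cases "c = 0")
  case False
  have "a div c \<le> (b + c) div c" using that False by (intro div_le_mono) auto
  then show ?thesis using False by simp
qed simp

text \<open>A vacant row \<open>v\<close>, and \<open>a\<close> digits in each other row that has any; \<open>a < n\<close> is what total
  disconnectedness amounts to.\<close>

locale uniform_carpet = carpet_coding +
  fixes v a :: nat
  assumes v_less: "v < m" and vacant: "(i, v) \<notin> D"
    and a_less: "a < n" and fiber: "(i, j) \<in> D \<Longrightarrow> card {i'. (i', j) \<in> D} = a"
begin

definition J :: "nat set" where "J = snd ` D"
definition s :: nat where "s = card J"

lemma finite_J: "finite J" using finite_D by (simp add: J_def)
lemma J_less: "j \<in> J \<Longrightarrow> j < m" using digit_less by (auto simp: J_def)
lemma s_pos: "s > 0" using D_nonempty finite_J by (auto simp: s_def J_def card_gt_0_iff)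
lemma finite_fiber: "finite {i. (i, j) \<in> D}"
  by (rule finite_subset[of _ "{..<n}"]) (use digit_less in auto)

lemma a_pos: "a > 0"
proof -
  obtain i j where ij: "(i, j) \<in> D" using D_nonempty by auto
  then have "{i'. (i', j) \<in> D} \<noteq> {}" by auto
  then show ?thesis using fiber[OF ij] finite_fiber[of j] by (metis card_gt_0_iff)
qed

lemma card_D: "card D = s * a"
  unfolding s_def J_def
proof (rule card_by_fibers[OF finite_D])
  fix d assume "d \<in> D"
  then have "(fst d, snd d) \<in> D" by simp
  have "{y\<in>D. snd y = snd d} = (\<lambda>i. (i, snd d)) ` {i. (i, snd d) \<in> D}" by force
  then show "card {y\<in>D. snd y = snd d} = a"
    using fiber[OF \<open>(fst d, snd d) \<in> D\<close>] by (simp add: card_image inj_on_def)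
qed

lemma col_less: "x \<in> codes \<Longrightarrow> col x k < n ^ k"
  and row_less: "x \<in> codes \<Longrightarrow> row x l < m ^ l"
  unfolding col_def row_def by (simp_all add: radix_less code_digit_less)

lemma col_eq_iff: "x \<in> codes \<Longrightarrow> y \<in> codes \<Longrightarrow> col x k = col y k \<longleftrightarrow> (\<forall>t<k. fst (x t) = fst (y t))"
  and row_eq_iff: "x \<in> codes \<Longrightarrow> y \<in> codes \<Longrightarrow> row x l = row y l \<longleftrightarrow> (\<forall>t<l. snd (x t) = snd (y t))"
  unfolding col_def row_def by (simp_all add: radix_eq_iff code_digit_less)

lemma col_div: "x \<in> codes \<Longrightarrow> k \<le> k' \<Longrightarrow> col x k' div n ^ (k' - k) = col x k"
  unfolding col_def using radix_div[of "\<lambda>t. fst (x t)" n k "k' - k"] by (simp add: code_digit_less)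

lemma row_div: "x \<in> codes \<Longrightarrow> k \<le> k' \<Longrightarrow> row x k' div m ^ (k' - k) = row x k"
  unfolding row_def using radix_div[of "\<lambda>t. snd (x t)" m k "k' - k"] by (simp add: code_digit_less)

text \<open>The rectangle given by \<open>k\<close> column digits and \<open>l\<close> row digits, in integer coordinates. For
  \<open>l = L k\<close> these are the approximate squares of generation \<open>k\<close>.\<close>

definition sq :: "nat \<Rightarrow> nat \<Rightarrow> (nat \<Rightarrow> nat \<times> nat) \<Rightarrow> nat \<times> nat" where
  "sq k l x = (col x k, row x l)"

lemma finite_sq: "finite (sq k l ` P)" if "P \<subseteq> codes"
proof (rule finite_subset)
  show "sq k l ` P \<subseteq> {..<n ^ k} \<times> {..<m ^ l}"
    using that col_less row_less by (auto simp: sq_def)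
qed auto

lemma sq_eq_iff: "x \<in> codes \<Longrightarrow> y \<in> codes \<Longrightarrow>
    sq k l x = sq k l y \<longleftrightarrow> (\<forall>t<k. fst (x t) = fst (y t)) \<and> (\<forall>t<l. snd (x t) = snd (y t))"
  by (simp add: sq_def col_eq_iff row_eq_iff)

lemma sq_coarsen: "sq k l x = sq k l y"
  if "sq k' l' x = sq k' l' y" "k \<le> k'" "l \<le> l'" "x \<in> codes" "y \<in> codes"
  using that by (simp add: sq_eq_iff)

text \<open>A set of codes that is a union of rectangles of type \<open>(k, l)\<close>.\<close>

definition cylinder :: "nat \<Rightarrow> nat \<Rightarrow> (nat \<Rightarrow> nat \<times> nat) set \<Rightarrow> bool" where
  "cylinder k l P \<longleftrightarrow> P \<subseteq> codes \<and> (\<forall>x\<in>P. \<forall>y\<in>codes. sq k l x = sq k l y \<longrightarrow> y \<in> P)"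

lemma cylinder_mono: "cylinder k l P \<Longrightarrow> k \<le> k' \<Longrightarrow> l \<le> l' \<Longrightarrow> cylinder k' l' P"
  unfolding cylinder_def using sq_coarsen by blast

lemma cylinder_codes: "cylinder k l P \<Longrightarrow> P \<subseteq> codes" by (simp add: cylinder_def)

lemma code_upd: "x \<in> codes \<Longrightarrow> d \<in> D \<Longrightarrow> x(t := d) \<in> codes" by (simp add: codes_def)

lemma col_upd: "k \<le> t \<Longrightarrow> col (x(t := d)) k = col x k"
  and row_upd: "k \<le> t \<Longrightarrow> row (x(t := d)) k = row x k"
  unfolding col_def row_def by (auto intro: radix_cong)

lemma row_upd_same: "snd d = snd (x t) \<Longrightarrow> row (x(t := d)) l = row x l"
  unfolding row_def by (auto intro: radix_cong)

text \<open>Because \<open>k < l\<close>, the row digit at position \<open>k\<close> is already determined, so the next column digit has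
  exactly \<open>a\<close> values.\<close>

lemma card_col_step:
  assumes P: "cylinder k l P" and "k < l"
  shows "card (sq (Suc k) l ` P) = card (sq k l ` P) * a"
proof -
  define f where "f p = (fst p div n, snd p)" for p :: "nat \<times> nat"
  have f: "f (sq (Suc k) l x) = sq k l x" if "x \<in> P" for x
    using that code_digit_less(1)[of x k] cylinder_codes[OF P] by (auto simp: f_def sq_def)
  have "card (sq (Suc k) l ` P) = card (f ` sq (Suc k) l ` P) * a"
  proof (rule card_by_fibers)
    show "finite (sq (Suc k) l ` P)" using finite_sq cylinder_codes[OF P] .
    fix p assume "p \<in> sq (Suc k) l ` P"
    then obtain x where x: "x \<in> P" "p = sq (Suc k) l x" by auto
    have xc: "x \<in> codes" using x cylinder_codes[OF P] by auto
    define j where "j = snd (x k)"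
    have xk: "(fst (x k), j) \<in> D" using codesD[OF xc, of k] by (simp add: j_def)
    have "{y \<in> sq (Suc k) l ` P. f y = f p} = (\<lambda>i. (col x k * n + i, row x l)) ` {i. (i, j) \<in> D}"
    proof (intro equalityI subsetI)
      fix y assume "y \<in> {y \<in> sq (Suc k) l ` P. f y = f p}"
      then obtain z where z: "z \<in> P" "y = sq (Suc k) l z" "sq k l z = sq k l x"
        using f x by auto
      have zc: "z \<in> codes" using z cylinder_codes[OF P] by auto
      have "snd (z k) = j" using z(3) \<open>k < l\<close> unfolding sq_eq_iff[OF zc xc] j_def by simp
      then have "(fst (z k), j) \<in> D" using codesD[OF zc, of k] by (metis prod.collapse)
      moreover have "y = (col x k * n + fst (z k), row x l)" using z by (simp add: sq_def)
      ultimately show "y \<in> (\<lambda>i. (col x k * n + i, row x l)) ` {i. (i, j) \<in> D}" by auto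
    next
      fix y assume "y \<in> (\<lambda>i. (col x k * n + i, row x l)) ` {i. (i, j) \<in> D}"
      then obtain i where i: "(i, j) \<in> D" "y = (col x k * n + i, row x l)" by auto
      let ?z = "x(k := (i, j))"
      have zc: "?z \<in> codes" using xc i(1) by (rule code_upd)
      have e: "sq k l ?z = sq k l x" "sq (Suc k) l ?z = y"
        using i by (simp_all add: sq_def col_upd row_upd_same j_def)
      then have "?z \<in> P" using P x(1) zc unfolding cylinder_def by metis
      then have "y \<in> sq (Suc k) l ` P" "f y = f p" using e x f by force+
      then show "y \<in> {y \<in> sq (Suc k) l ` P. f y = f p}" by simp
    qed
    then show "card {y \<in> sq (Suc k) l ` P. f y = f p} = a"
      using fiber[OF xk] by (simp add: card_image inj_on_def)
  qed
  moreover have "f ` sq (Suc k) l ` P = sq k l ` P" using f by force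
  ultimately show ?thesis by simp
qed

text \<open>Because \<open>k \<le> l\<close>, the column digit at position \<open>l\<close> is not yet visible, so the row digit is
  free to be any non-vacant one.\<close>

lemma card_row_step:
  assumes P: "cylinder k l P" and "k \<le> l"
  shows "card (sq k (Suc l) ` P) = card (sq k l ` P) * s"
proof -
  define f where "f p = (fst p, snd p div m)" for p :: "nat \<times> nat"
  have f: "f (sq k (Suc l) x) = sq k l x" if "x \<in> P" for x
    using that code_digit_less(2)[of x l] cylinder_codes[OF P] by (auto simp: f_def sq_def)
  have "card (sq k (Suc l) ` P) = card (f ` sq k (Suc l) ` P) * s"
  proof (rule card_by_fibers)
    show "finite (sq k (Suc l) ` P)" using finite_sq cylinder_codes[OF P] .
    fix p assume "p \<in> sq k (Suc l) ` P"
    then obtain x where x: "x \<in> P" "p = sq k (Suc l) x" by auto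
    have xc: "x \<in> codes" using x cylinder_codes[OF P] by auto
    have "{y \<in> sq k (Suc l) ` P. f y = f p} = (\<lambda>j. (col x k, row x l * m + j)) ` J"
    proof (intro equalityI subsetI)
      fix y assume "y \<in> {y \<in> sq k (Suc l) ` P. f y = f p}"
      then obtain z where z: "z \<in> P" "y = sq k (Suc l) z" "sq k l z = sq k l x"
        using f x by auto
      have "snd (z l) \<in> J" using z(1) cylinder_codes[OF P] codesD by (auto simp: J_def)
      moreover have "y = (col x k, row x l * m + snd (z l))" using z by (simp add: sq_def)
      ultimately show "y \<in> (\<lambda>j. (col x k, row x l * m + j)) ` J" by auto
    next
      fix y assume "y \<in> (\<lambda>j. (col x k, row x l * m + j)) ` J"
      then obtain d where d: "d \<in> D" "y = (col x k, row x l * m + snd d)" by (auto simp: J_def)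
      let ?z = "x(l := d)"
      have zc: "?z \<in> codes" using xc d(1) by (rule code_upd)
      have e: "sq k l ?z = sq k l x" "sq k (Suc l) ?z = y"
        using d \<open>k \<le> l\<close> by (simp_all add: sq_def col_upd row_upd)
      then have "?z \<in> P" using P x(1) zc unfolding cylinder_def by metis
      then have "y \<in> sq k (Suc l) ` P" "f y = f p" using e x f by force+
      then show "y \<in> {y \<in> sq k (Suc l) ` P. f y = f p}" by simp
    qed
    then show "card {y \<in> sq k (Suc l) ` P. f y = f p} = s"
      by (simp add: card_image inj_on_def s_def)
  qed
  moreover have "f ` sq k (Suc l) ` P = sq k l ` P" using f by force
  ultimately show ?thesis by simp
qed

text \<open>The rows are refined first: this keeps \<open>k < l\<close> in each refinement of the columns.\<close>

lemma card_sq: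
  assumes P: "cylinder k l P" and "k \<le> l" "k \<le> k'" "l \<le> l'" "k' \<le> l'"
  shows "card (sq k' l' ` P) = card (sq k l ` P) * a ^ (k' - k) * s ^ (l' - l)"
proof -
  have 1: "card (sq k (l + t) ` P) = card (sq k l ` P) * s ^ t" for t
  proof (induction t)
    case (Suc t)
    show ?case
      using card_row_step[OF cylinder_mono[OF P order_refl, of "l + t"]] \<open>k \<le> l\<close> Suc by simp
  qed simp
  have 2: "card (sq (k + t) l' ` P) = card (sq k l' ` P) * a ^ t" if "k + t \<le> l'" for t
    using that
  proof (induction t)
    case (Suc t)
    show ?case
      using card_col_step[OF cylinder_mono[OF P, of "k + t" l']] \<open>l \<le> l'\<close> Suc by simp
  qed simp
  show ?thesis using 1[of "l' - l"] 2[of "k' - k"] assms by (simp add: mult.assoc mult.commute)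
qed

lemma cylinder_square: "cylinder k l {z\<in>codes. sq k l z = p}"
  by (auto simp: cylinder_def)

end


section \<open>Clusters of touching squares\<close>

context uniform_carpet
begin

definition adj :: "nat \<Rightarrow> nat \<Rightarrow> (nat \<Rightarrow> nat \<times> nat) \<Rightarrow> (nat \<Rightarrow> nat \<times> nat) \<Rightarrow> bool" where
  "adj k l x y \<longleftrightarrow> x \<in> codes \<and> y \<in> codes \<and> near (sq k l x) (sq k l y)"

abbreviation conn :: "nat \<Rightarrow> nat \<Rightarrow> (nat \<Rightarrow> nat \<times> nat) \<Rightarrow> (nat \<Rightarrow> nat \<times> nat) \<Rightarrow> bool" where
  "conn k l \<equiv> (adj k l)\<^sup>*\<^sup>*"

lemma adj_sym: "adj k l x y \<Longrightarrow> adj k l y x" by (auto simp: adj_def near_def)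

lemma adj_if_sq_eq: "x \<in> codes \<Longrightarrow> y \<in> codes \<Longrightarrow> sq k l x = sq k l y \<Longrightarrow> adj k l x y"
  by (simp add: adj_def near_def)

lemma conn_sym: "conn k l x y \<Longrightarrow> conn k l y x"
  using adj_sym by (metis sympI sympD symp_rtranclp)

lemma conn_codes: "conn k l x y \<Longrightarrow> x \<in> codes \<Longrightarrow> y \<in> codes"
  by (induction rule: rtranclp_induct) (auto simp: adj_def)

text \<open>Coarsening divides integer coordinates, and this does not increase a difference of at most \<open>1\<close>.\<close>

lemma adj_coarsen:
  assumes "adj k' l' x y" "k \<le> k'" "l \<le> l'"
  shows "adj k l x y"
proof -
  have c: "x \<in> codes" "y \<in> codes" using assms by (auto simp: adj_def)
  have "near (sq k l x) (sq k l y)"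
    using assms(1) div_le_div_plus_1[of _ _ "n ^ (k' - k)"] div_le_div_plus_1[of _ _ "m ^ (l' - l)"]
    unfolding adj_def near_def sq_def fst_conv snd_conv
      col_div[OF c(1) assms(2), symmetric] col_div[OF c(2) assms(2), symmetric]
      row_div[OF c(1) assms(3), symmetric] row_div[OF c(2) assms(3), symmetric]
    by blast
  then show ?thesis using c by (simp add: adj_def)
qed

lemma conn_coarsen: "conn k' l' x y \<Longrightarrow> k \<le> k' \<Longrightarrow> l \<le> l' \<Longrightarrow> conn k l x y"
  by (induction rule: rtranclp_induct) (auto intro: rtranclp.rtrancl_into_rtrancl dest: adj_coarsen)

text \<open>The number of rows \<open>q < r\<close> with last digit \<open>v\<close>. It is constant between two such rows, and these are
  vacant.\<close>

definition strip :: "nat \<Rightarrow> nat" where "strip r = (r + (m - 1 - v)) div m"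

lemma strip_Suc: "strip (Suc r) = strip r" if "r mod m \<noteq> v"
proof -
  have "Suc (r + (m - 1 - v)) mod m \<noteq> 0"
  proof
    assume "Suc (r + (m - 1 - v)) mod m = 0"
    then obtain c where "Suc (r + (m - 1 - v)) = m * c" by (auto elim: dvdE dest: mod_0_imp_dvd)
    then have "r + m = m * c + v" using v_less by linarith
    then have "(r + m) mod m = v" using v_less by simp
    then show False using that by simp
  qed
  then show ?thesis by (simp add: strip_def div_Suc)
qed

lemma row_digit_not_v: "x \<in> codes \<Longrightarrow> row x (Suc l) mod m \<noteq> v"
  using vacant codesD[of x l] code_digit_less(2)[of x l] by (metis mod_mult_self3 mod_less prod.collapse row_simps(2))

lemma conn_strip: "conn k (Suc l) x y \<Longrightarrow> strip (row x (Suc l)) = strip (row y (Suc l))"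
proof (induction rule: rtranclp_induct)
  case (step y z)
  have c: "y \<in> codes" "z \<in> codes" using step(2) by (auto simp: adj_def)
  have "row y (Suc l) = row z (Suc l) \<or> row y (Suc l) = Suc (row z (Suc l)) \<or> row z (Suc l) = Suc (row y (Suc l))"
    using step(2) unfolding adj_def near_def sq_def by auto
  then show ?case using step(3) strip_Suc row_digit_not_v c by metis
qed simp

lemma strip_eq_less: "strip r = strip r' \<Longrightarrow> r < r' + m"
proof -
  assume a: "strip r = strip r'"
  have "r + (m - 1 - v) < strip r * m + m"
    unfolding strip_def using m2 dividend_less_div_times[of m "r + (m - 1 - v)"] by linarith
  moreover have "strip r' * m \<le> r' + (m - 1 - v)" unfolding strip_def by simp
  ultimately show ?thesis using a by simp
qed

lemma conn_row_less: "conn k l x y \<Longrightarrow> row x l < row y l + m"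
  using conn_strip[of k "l - 1" x y] strip_eq_less m2 by (cases l) auto

text \<open>Exists because \<open>a < n\<close>. Any \<open>m\<close> rows occupy fewer than all of the \<open>n ^ gap_exp\<close> columns of
  a block.\<close>

definition gap_exp :: nat where "gap_exp = (SOME t. m * a ^ t < n ^ t)"

lemma gap_exp: "m * a ^ gap_exp < n ^ gap_exp"
  unfolding gap_exp_def
proof (rule someI_ex)
  have "real n / real a > 1" using a_less a_pos by simp
  then obtain k where "real m < (real n / real a) ^ k" using real_arch_pow by blast
  then have "real m * real a ^ k < real n ^ k"
    using a_pos by (simp add: power_divide pos_less_divide_eq)
  then have "real (m * a ^ k) < real (n ^ k)" by simp
  then show "\<exists>k. m * a ^ k < n ^ k" using of_nat_less_iff by blast
qed

text \<open>The rows met by the cluster lie in a window of length \<open>m\<close>. In the block of \<open>n ^ gap_exp\<close> columns to the right of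
  the block of \<open>x\<close>, they occupy at most \<open>m * a ^ gap_exp\<close> columns. So some column \<open>g\<close> of
  that block is free, and a chain of touching squares that starts to the left of \<open>g\<close>
  stays there.\<close>

lemma conn_col_less:
  assumes x: "x \<in> codes" and xy: "conn k l x y" and "k \<le> l"
  shows "col y k < col x k + 2 * n ^ gap_exp"
proof (cases "k < gap_exp")
  case True
  have "col y k < n ^ k" using col_less conn_codes xy x by blast
  also have "\<dots> \<le> n ^ gap_exp" using True n2 by (intro power_increasing) auto
  finally show ?thesis by simp
next
  case False
  define C where "C = {z. conn k l x z}"
  have C: "z \<in> codes" if "z \<in> C" for z using that conn_codes x by (auto simp: C_def)
  \<comment> \<open>\<open>b\<close>: the block to the right of that of \<open>x\<close>; \<open>R\<close>: the rows of the cluster; \<open>U\<close>: its columns in block \<open>b\<close>.\<close>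
  define b where "b = col x (k - gap_exp) + 1"
  define R where "R = (\<lambda>z. row z l) ` C"
  define U where "U = {col z k | z. z \<in> C \<and> col z (k - gap_exp) = b}"
  have "R \<subseteq> {..<m ^ l}" using C row_less by (auto simp: R_def)
  then have finR: "finite R" by (rule finite_subset) simp
  have "R \<noteq> {}" by (auto simp: R_def C_def)
  have "R \<subseteq> {Min R..<Min R + m}"
  proof
    fix r assume r: "r \<in> R"
    have "Min R \<in> R" using finR \<open>R \<noteq> {}\<close> by (rule Min_in)
    then obtain z z' where z: "conn k l x z" "conn k l x z'" "r = row z l" "Min R = row z' l"
      using r by (auto simp: R_def C_def)
    have "conn k l z z'" using z conn_sym by (meson rtranclp_trans)
    then have "r < Min R + m" using conn_row_less z(3,4) by metis
    then show "r \<in> {Min R..<Min R + m}" using Min_le[OF finR r] by simp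
  qed
  from card_mono[OF _ this] have cR: "card R \<le> m" by simp
  have "card ((\<lambda>z. col z k) ` {z\<in>codes. sq (k - gap_exp) l z = (b, r)}) \<le> a ^ gap_exp" for r
  proof -
    let ?P = "{z\<in>codes. sq (k - gap_exp) l z = (b, r)}"
    have "card (sq k l ` ?P) = card (sq (k - gap_exp) l ` ?P) * a ^ (k - (k - gap_exp)) * s ^ (l - l)"
      using \<open>k \<le> l\<close> by (intro card_sq cylinder_square) auto
    moreover have "sq (k - gap_exp) l ` ?P \<subseteq> {(b, r)}" by auto
    from card_mono[OF _ this] have "card (sq (k - gap_exp) l ` ?P) \<le> 1" by simp
    ultimately have "card (sq k l ` ?P) \<le> a ^ gap_exp" using False by simp
    moreover have "(\<lambda>z. col z k) ` ?P = fst ` sq k l ` ?P" by (auto simp: sq_def image_iff)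
    moreover have "card (fst ` sq k l ` ?P) \<le> card (sq k l ` ?P)"
      by (rule card_image_le) (rule finite_sq, auto)
    ultimately show ?thesis by simp
  qed
  then have "(\<Sum>r\<in>R. card ((\<lambda>z. col z k) ` {z\<in>codes. sq (k - gap_exp) l z = (b, r)})) \<le> (\<Sum>r\<in>R. a ^ gap_exp)"
    by (intro sum_mono)
  moreover define V where "V = (\<Union>r\<in>R. (\<lambda>z. col z k) ` {z\<in>codes. sq (k - gap_exp) l z = (b, r)})"
  ultimately have "card V \<le> card R * a ^ gap_exp"
    using card_UN_le[OF finR, of "\<lambda>r. (\<lambda>z. col z k) ` {z\<in>codes. sq (k - gap_exp) l z = (b, r)}"]
    by simp
  moreover have "finite V"
    unfolding V_def by (rule finite_subset[of _ "{..<n ^ k}"]) (use col_less in auto)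
  moreover have UV: "U \<subseteq> V" using C by (auto simp: U_def R_def sq_def V_def)
  ultimately have finU: "finite U" and "card U \<le> card R * a ^ gap_exp"
    using finite_subset[of U V] card_mono[of V U] by auto
  note this(2)
  also have "\<dots> \<le> m * a ^ gap_exp" using cR by simp
  also have "\<dots> < card {b * n ^ gap_exp..<(b + 1) * n ^ gap_exp}" using gap_exp by simp
  finally have "\<not> {b * n ^ gap_exp..<(b + 1) * n ^ gap_exp} \<subseteq> U"
    using card_mono[OF finU] by (metis linorder_not_le)
  then obtain g where "g \<in> {b * n ^ gap_exp..<(b + 1) * n ^ gap_exp}" and gU: "g \<notin> U" by blast
  then have g: "b * n ^ gap_exp \<le> g" "g < (b + 1) * n ^ gap_exp" by auto
  have "g div n ^ gap_exp = b"
  proof (rule div_nat_eqI)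
    show "n ^ gap_exp * b \<le> g" "g < n ^ gap_exp * Suc b" using g by (simp_all add: mult.commute)
  qed
  then have ng: "col z k \<noteq> g" if "z \<in> C" for z
    using that gU col_div[OF C[OF that], of "k - gap_exp" k] False by (auto simp: U_def)
  have xdiv: "col x k div n ^ gap_exp = col x (k - gap_exp)" using col_div[OF x, of "k - gap_exp" k] False by simp
  from xy have "col y k < g"
  proof (induction rule: rtranclp_induct)
    case base
    have "col x k < (col x k div n ^ gap_exp + 1) * n ^ gap_exp"
      using n2 by (simp add: dividend_less_div_times)
    then show ?case using g(1) unfolding xdiv b_def by simp
  next
    case (step y z)
    have "z \<in> C" unfolding C_def using step(1,2) by simp
    moreover have "col z k \<le> col y k + 1" using step(2) by (simp add: adj_def near_def sq_def)
    ultimately show ?case using ng step(3) by fastforce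
  qed
  moreover have "col x (k - gap_exp) * n ^ gap_exp \<le> col x k" unfolding xdiv[symmetric] by simp
  ultimately show ?thesis using g(2) unfolding b_def by (simp add: algebra_simps)
qed

end


section \<open>Distances between clusters\<close>

context uniform_carpet
begin

text \<open>Closed rectangles that do not touch are separated by a whole column or a whole row. Rows of type
  \<open>L k + 1\<close> are at least as high as columns of type \<open>k + 1\<close> are wide.\<close>

lemma not_adj_dist:
  assumes x: "x \<in> codes" and y: "y \<in> codes" and "\<not> adj (Suc k) (Suc (L k)) x y"
  shows "(1 / real n) ^ Suc k \<le> dist (pt x) (pt y)"
proof -
  have scale: "1 \<le> \<bar>f - g\<bar> * c" if "real p \<le> f * c" "g * c \<le> real p' + 1" "p' + 2 \<le> p" "0 \<le> c" for f g c :: real and p p' :: nat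
  proof -
    have "real p' + 2 \<le> real p" using that(3) by linarith
    then have "1 \<le> f * c - g * c" using that by linarith
    also have "\<dots> = (f - g) * c" by (simp add: left_diff_distrib)
    also have "\<dots> \<le> \<bar>f - g\<bar> * c" using that(4) by (intro mult_right_mono) auto
    finally show ?thesis .
  qed
  note cx = pt_coded[OF x, unfolded coded_by_def, rule_format]
  note cy = pt_coded[OF y, unfolded coded_by_def, rule_format]
  consider "col x (Suc k) + 2 \<le> col y (Suc k) \<or> col y (Suc k) + 2 \<le> col x (Suc k)"
    | "row x (Suc (L k)) + 2 \<le> row y (Suc (L k)) \<or> row y (Suc (L k)) + 2 \<le> row x (Suc (L k))"
    using assms by (auto simp: adj_def near_def sq_def simp del: col_simps row_simps)
  then show ?thesis
  proof cases
    case 1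
    then have "1 \<le> \<bar>fst (pt x) - fst (pt y)\<bar> * real n ^ Suc k"
      using scale[of "col x (Suc k)" "fst (pt x)" "real n ^ Suc k" "fst (pt y)" "col y (Suc k)"]
        scale[of "col y (Suc k)" "fst (pt y)" "real n ^ Suc k" "fst (pt x)" "col x (Suc k)"]
        cx[of "Suc k"] cy[of "Suc k"] by (auto simp: abs_minus_commute simp del: col_simps row_simps power_Suc)
    then have "(1 / real n) ^ Suc k \<le> \<bar>fst (pt x) - fst (pt y)\<bar>"
      using n2 by (simp add: power_divide pos_divide_le_eq)
    also have "\<dots> \<le> dist (pt x) (pt y)" using dist_fst_le[of "pt x" "pt y"] by (simp add: dist_real_def)
    finally show ?thesis .
  next
    case 2
    then have *: "1 \<le> \<bar>snd (pt x) - snd (pt y)\<bar> * real m ^ Suc (L k)"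
      using scale[of "row x (Suc (L k))" "snd (pt x)" "real m ^ Suc (L k)" "snd (pt y)" "row y (Suc (L k))"]
        scale[of "row y (Suc (L k))" "snd (pt y)" "real m ^ Suc (L k)" "snd (pt x)" "row x (Suc (L k))"]
        cx[of "Suc (L k)"] cy[of "Suc (L k)"] by (auto simp: abs_minus_commute simp del: col_simps row_simps power_Suc)
    have "m ^ Suc (L k) \<le> n ^ Suc k"
      using mult_mono[of m n "m ^ L k" "n ^ k"] L_bounds(1)[of k] mn by simp
    then have "real m ^ Suc (L k) \<le> real n ^ Suc k"
      by (metis of_nat_le_iff of_nat_power)
    then have "\<bar>snd (pt x) - snd (pt y)\<bar> * real m ^ Suc (L k) \<le> \<bar>snd (pt x) - snd (pt y)\<bar> * real n ^ Suc k"
      by (intro mult_left_mono) auto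
    with * have "1 \<le> \<bar>snd (pt x) - snd (pt y)\<bar> * real n ^ Suc k" by linarith
    then have "(1 / real n) ^ Suc k \<le> \<bar>snd (pt x) - snd (pt y)\<bar>"
      using n2 by (simp add: power_divide pos_divide_le_eq)
    also have "\<dots> \<le> dist (pt x) (pt y)" using dist_snd_le[of "pt x" "pt y"] by (simp add: dist_real_def)
    finally show ?thesis .
  qed
qed

text \<open>A cluster has a bounded number of rows and columns, and the height of a row is at most \<open>m\<close> times
  the width of a column.\<close>

lemma conn_dist:
  assumes x: "x \<in> codes" and xy: "conn k (L k) x y"
  shows "dist (pt x) (pt y) \<le> (2 * real n ^ gap_exp + 1 + real m * (real m + 1)) * (1 / real n) ^ k"
proof -
  have y: "y \<in> codes" using conn_codes xy x by blast
  have yx: "conn k (L k) y x" using xy by (rule conn_sym)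
  note cx = pt_coded[OF x, unfolded coded_by_def, rule_format]
  note cy = pt_coded[OF y, unfolded coded_by_def, rule_format]
  have scale: "\<bar>f - g\<bar> * c \<le> real q + 1"
    if "real p \<le> f * c" "f * c \<le> real p + 1" "real p' \<le> g * c" "g * c \<le> real p' + 1" "p' < p + q" "p < p' + q" "0 \<le> c"
    for f g c :: real and p p' q :: nat
  proof -
    have "real p' \<le> real p + real q" "real p \<le> real p' + real q" using that by linarith+
    then have "\<bar>f * c - g * c\<bar> \<le> real q + 1" using that by linarith
    then show ?thesis using that(7) by (simp add: left_diff_distrib[symmetric] abs_mult)
  qed
  have "\<bar>fst (pt x) - fst (pt y)\<bar> * real n ^ k \<le> real (2 * n ^ gap_exp) + 1"
    using conn_col_less[OF x xy le_L] conn_col_less[OF y yx le_L] cx[of k] cy[of k]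
    by (intro scale[of "col x k" _ _ "col y k"]) auto
  then have 1: "\<bar>fst (pt x) - fst (pt y)\<bar> \<le> (2 * real n ^ gap_exp + 1) * (1 / real n) ^ k"
    using n2 by (simp add: power_divide pos_le_divide_eq)
  have 2: "\<bar>snd (pt x) - snd (pt y)\<bar> * real m ^ L k \<le> real m + 1"
    using conn_row_less[OF xy] conn_row_less[OF yx] cx[of "L k"] cy[of "L k"]
    by (intro scale[of "row x (L k)" _ _ "row y (L k)"]) auto
  have "real n ^ k \<le> real m ^ L k * real m"
    using L_bounds(2)[of k] by (metis less_imp_le mult.commute of_nat_le_iff of_nat_power power_Suc of_nat_mult)
  then have "\<bar>snd (pt x) - snd (pt y)\<bar> * real n ^ k \<le> \<bar>snd (pt x) - snd (pt y)\<bar> * (real m ^ L k * real m)"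
    by (intro mult_left_mono) auto
  also have "\<dots> \<le> (real m + 1) * real m"
    using mult_right_mono[OF 2, of "real m"] by (simp add: mult.assoc)
  finally have 3: "\<bar>snd (pt x) - snd (pt y)\<bar> \<le> (real m * (real m + 1)) * (1 / real n) ^ k"
    using n2 by (simp add: power_divide pos_le_divide_eq mult.commute)
  have "dist (pt x) (pt y) \<le> \<bar>fst (pt x) - fst (pt y)\<bar> + \<bar>snd (pt x) - snd (pt y)\<bar>"
    unfolding dist_prod_def dist_real_def using sqrt_sum_squares_le_sum_abs by simp
  then show ?thesis using 1 3 by (simp only: distrib_right)
qed

end


section \<open>Pieces and their weights\<close>

context uniform_carpet
begin

lemma card_D_cancel: "p * card D = q * card D \<Longrightarrow> p = q"
  using D_card by simp

text \<open>The squares of generation \<open>k\<close> are cut once more, by one column digit and one row digit, so that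
  vacant columns and rows of the next digits become visible. One square of generation \<open>k\<close>
  consists of \<open>a * s = card D\<close> fine squares, and the squares of generation \<open>k + 1\<close> refine the fine
  ones because \<open>L k + 1 \<le> L (k + 1)\<close>.\<close>

definition fine_sq :: "nat \<Rightarrow> (nat \<Rightarrow> nat \<times> nat) \<Rightarrow> nat \<times> nat" where
  "fine_sq k = sq (Suc k) (Suc (L k))"

definition cluster :: "nat \<Rightarrow> (nat \<Rightarrow> nat \<times> nat) \<Rightarrow> (nat \<Rightarrow> nat \<times> nat) set" where
  "cluster k x = {y. conn k (L k) x y}"

text \<open>The fine squares in \<open>S\<close> are a part of the cluster \<open>C\<close> that has the weight of one square and does not touch
  the rest.\<close>

definition splits :: "nat \<Rightarrow> (nat \<Rightarrow> nat \<times> nat) set \<Rightarrow> (nat \<times> nat) set \<Rightarrow> bool" where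
  "splits k C S \<longleftrightarrow> S \<subseteq> fine_sq k ` C \<and> card S = card D \<and>
     (\<forall>x y. adj (Suc k) (Suc (L k)) x y \<longrightarrow> fine_sq k x \<in> S \<longrightarrow> fine_sq k y \<in> S)"

text \<open>The part of weight one that is cut off from the cluster; empty if there is no such part.\<close>

definition core :: "nat \<Rightarrow> (nat \<Rightarrow> nat \<times> nat) set \<Rightarrow> (nat \<times> nat) set" where
  "core k C = (if \<exists>S. splits k C S then SOME S. splits k C S else {})"

text \<open>The piece of a code is its cluster together with the information on which side of the cut it
  lies.\<close>

definition piece :: "nat \<Rightarrow> (nat \<Rightarrow> nat \<times> nat) \<Rightarrow> (nat \<Rightarrow> nat \<times> nat) set \<times> bool" where
  "piece k x = (cluster k x, fine_sq k x \<in> core k (cluster k x))"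

definition weight :: "nat \<Rightarrow> (nat \<Rightarrow> nat \<times> nat) set \<times> bool \<Rightarrow> nat" where
  "weight k A = card (fine_sq k ` {x\<in>codes. piece k x = A}) div card D"

lemma cluster_eq: "conn k (L k) x y \<Longrightarrow> cluster k x = cluster k y"
  unfolding cluster_def using conn_sym by (blast intro: rtranclp_trans)

lemma cluster_codes: "x \<in> codes \<Longrightarrow> cluster k x \<subseteq> codes" using conn_codes by (auto simp: cluster_def)

lemma self_in_cluster: "x \<in> cluster k x" by (simp add: cluster_def)

lemma core_cases: "core k C = {} \<or> splits k C (core k C)"
  by (auto simp: core_def intro: someI)

lemma core_subset: "core k C \<subseteq> fine_sq k ` C"
  using core_cases[of k C] by (auto simp: splits_def)

lemma core_closed: "adj (Suc k) (Suc (L k)) x y \<Longrightarrow> fine_sq k x \<in> core k C \<Longrightarrow> fine_sq k y \<in> core k C"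
  using core_cases[of k C] unfolding splits_def by auto

lemma adj_piece:
  assumes "adj (Suc k) (Suc (L k)) x y"
  shows "piece k x = piece k y"
proof -
  have "conn k (L k) x y" using adj_coarsen[OF assms, of k "L k"] by auto
  then have "cluster k x = cluster k y" by (rule cluster_eq)
  moreover have "fine_sq k x \<in> core k C \<longleftrightarrow> fine_sq k y \<in> core k C" for C
    using core_closed[OF assms] core_closed[OF adj_sym[OF assms]] by blast
  ultimately show ?thesis by (simp add: piece_def)
qed

lemma piece_eq_if_fine_sq_eq: "x \<in> codes \<Longrightarrow> y \<in> codes \<Longrightarrow> fine_sq k x = fine_sq k y \<Longrightarrow> piece k x = piece k y"
  by (rule adj_piece) (auto simp: fine_sq_def intro: adj_if_sq_eq)

lemma conn_if_piece_eq: "piece k x = piece k y \<Longrightarrow> conn k (L k) x y"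
proof -
  assume "piece k x = piece k y"
  then have "y \<in> cluster k x" using self_in_cluster[of y k] by (simp add: piece_def)
  then show "conn k (L k) x y" by (simp add: cluster_def)
qed

lemma piece_refine:
  assumes "piece (Suc k) x = piece (Suc k) y"
  shows "piece k x = piece k y"
proof -
  have "conn (Suc k) (L (Suc k)) x y" using assms by (rule conn_if_piece_eq)
  then show ?thesis
  proof (induction rule: rtranclp_induct)
    case (step y z)
    have "adj (Suc k) (Suc (L k)) y z" using adj_coarsen[OF step(2) order_refl L_Suc] .
    then show ?case using adj_piece step(3) by simp
  qed simp
qed

lemma piece_coarsen: "piece k x = piece k y" if "piece k' x = piece k' y" "k \<le> k'"
  using that(2,1) by (induction k' rule: dec_induct) (auto dest: piece_refine)

lemma cylinder_piece: "cylinder (Suc k) (Suc (L k)) {x\<in>codes. piece k x = A}"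
  unfolding cylinder_def
proof (intro conjI ballI impI)
  fix x y assume x: "x \<in> {x\<in>codes. piece k x = A}" and y: "y \<in> codes"
    and e: "sq (Suc k) (Suc (L k)) x = sq (Suc k) (Suc (L k)) y"
  have "piece k x = piece k y" by (rule piece_eq_if_fine_sq_eq) (use x y e in \<open>auto simp: fine_sq_def\<close>)
  then show "y \<in> {x\<in>codes. piece k x = A}" using x y by simp
qed auto

lemma cylinder_cluster:
  assumes "x \<in> codes"
  shows "cylinder k (L k) (cluster k x)"
  unfolding cylinder_def
proof (intro conjI ballI impI)
  show "cluster k x \<subseteq> codes" using assms by (rule cluster_codes)
  fix z y assume z: "z \<in> cluster k x" and y: "y \<in> codes" and e: "sq k (L k) z = sq k (L k) y"
  have "adj k (L k) z y" using adj_if_sq_eq[OF _ y e] z cluster_codes[OF assms] by blast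
  then show "y \<in> cluster k x" using z by (auto simp: cluster_def)
qed

lemma card_fine_sq_cluster:
  assumes "x \<in> codes"
  shows "card (fine_sq k ` cluster k x) = card (sq k (L k) ` cluster k x) * card D"
  unfolding fine_sq_def using card_sq[OF cylinder_cluster[OF assms] le_L, of k "Suc k" "Suc (L k)"] le_L[of k]
  by (simp add: card_D Suc_diff_le)

lemma fine_sq_piece:
  assumes "x \<in> codes"
  shows "fine_sq k ` {y\<in>codes. piece k y = (cluster k x, True)} = core k (cluster k x)"
    and "fine_sq k ` {y\<in>codes. piece k y = (cluster k x, False)} = fine_sq k ` cluster k x - core k (cluster k x)"
proof -
  have cluster: "y \<in> codes \<and> cluster k y = cluster k x \<longleftrightarrow> y \<in> cluster k x" for y
  proof
    assume "y \<in> codes \<and> cluster k y = cluster k x"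
    then show "y \<in> cluster k x" using self_in_cluster[of y k] by simp
  next
    assume y: "y \<in> cluster k x"
    then have "conn k (L k) x y" by (simp add: cluster_def)
    then show "y \<in> codes \<and> cluster k y = cluster k x" using y cluster_codes[OF assms] cluster_eq by blast
  qed
  have 1: "{y\<in>codes. piece k y = (cluster k x, b)} = {y\<in>cluster k x. (fine_sq k y \<in> core k (cluster k x)) = b}" for b
  proof (intro set_eqI iffI)
    fix y assume "y \<in> {y\<in>codes. piece k y = (cluster k x, b)}"
    then show "y \<in> {y\<in>cluster k x. (fine_sq k y \<in> core k (cluster k x)) = b}"
      using cluster[of y] by (simp add: piece_def) metis
  next
    fix y assume "y \<in> {y\<in>cluster k x. (fine_sq k y \<in> core k (cluster k x)) = b}"
    then show "y \<in> {y\<in>codes. piece k y = (cluster k x, b)}"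
      using cluster[of y] by (simp add: piece_def)
  qed
  show "fine_sq k ` {y\<in>codes. piece k y = (cluster k x, True)} = core k (cluster k x)"
    unfolding 1 using core_subset[of k "cluster k x"] by auto
  show "fine_sq k ` {y\<in>codes. piece k y = (cluster k x, False)} = fine_sq k ` cluster k x - core k (cluster k x)"
    unfolding 1 by auto
qed

lemma finite_fine_sq: "P \<subseteq> codes \<Longrightarrow> finite (fine_sq k ` P)"
  unfolding fine_sq_def by (rule finite_sq)

text \<open>Weights are integers: a cluster consists of whole squares, and the core has the weight of one
  square or is empty.\<close>

lemma weight_mult:
  assumes x: "x \<in> codes"
  shows "weight k (piece k x) * card D = card (fine_sq k ` {y\<in>codes. piece k y = piece k x})"
proof -
  have fin: "finite (fine_sq k ` cluster k x)" using finite_fine_sq cluster_codes[OF x] .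
  have c: "card D dvd card (core k (cluster k x))"
    using core_cases[of k "cluster k x"] by (auto simp: splits_def)
  have "card D dvd card (fine_sq k ` cluster k x - core k (cluster k x))"
    using card_Diff_subset[OF finite_subset[OF core_subset fin] core_subset] c
    by (simp add: card_fine_sq_cluster[OF x] dvd_diff_nat)
  then have "card D dvd card (fine_sq k ` {y\<in>codes. piece k y = piece k x})"
    using c fine_sq_piece[OF x, of k] unfolding piece_def[of k x]
    by (cases "fine_sq k x \<in> core k (cluster k x)") simp_all
  then show ?thesis by (simp add: weight_def)
qed

lemma weight_core:
  assumes "x \<in> codes" "\<exists>S. splits k (cluster k x) S"
  shows "weight k (cluster k x, True) = 1"
proof -
  have "card (core k (cluster k x)) = card D"
  proof -
    have "splits k (cluster k x) (core k (cluster k x))"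
      using someI_ex[OF assms(2)] assms(2) by (simp add: core_def)
    then show ?thesis by (simp add: splits_def)
  qed
  then show ?thesis using D_card unfolding weight_def fine_sq_piece(1)[OF assms(1)] by simp
qed

definition max_weight :: nat where "max_weight = 4 * n ^ gap_exp * (2 * m)"

lemma card_cluster_le:
  assumes x: "x \<in> codes"
  shows "card (sq k (L k) ` cluster k x) \<le> max_weight"
proof -
  have "sq k (L k) ` cluster k x \<subseteq>
      {col x k - 2 * n ^ gap_exp..<col x k + 2 * n ^ gap_exp} \<times> {row x (L k) - m..<row x (L k) + m}"
  proof
    fix p assume "p \<in> sq k (L k) ` cluster k x"
    then obtain y where y: "conn k (L k) x y" "p = sq k (L k) y" by (auto simp: cluster_def)
    have yx: "conn k (L k) y x" "y \<in> codes" using y conn_sym conn_codes x by blast+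
    show "p \<in> {col x k - 2 * n ^ gap_exp..<col x k + 2 * n ^ gap_exp} \<times> {row x (L k) - m..<row x (L k) + m}"
      using conn_col_less[OF x y(1) le_L] conn_col_less[OF yx(2,1) le_L]
        conn_row_less[OF y(1)] conn_row_less[OF yx(1)] unfolding y(2) sq_def by auto
  qed
  from card_mono[OF _ this] have "card (sq k (L k) ` cluster k x) \<le>
     (col x k + 2 * n ^ gap_exp - (col x k - 2 * n ^ gap_exp)) * (row x (L k) + m - (row x (L k) - m))"
    by (simp add: card_cartesian_product)
  also have "\<dots> \<le> 4 * n ^ gap_exp * (2 * m)" by (intro mult_mono) auto
  finally show ?thesis by (simp add: max_weight_def)
qed

lemma weight_bounds:
  assumes x: "x \<in> codes"
  shows "1 \<le> weight k (piece k x) \<and> weight k (piece k x) \<le> max_weight"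
proof
  let ?P = "{y\<in>codes. piece k y = piece k x}"
  have "fine_sq k ` ?P \<noteq> {}" using x by auto
  moreover have "finite (fine_sq k ` ?P)" by (rule finite_fine_sq) auto
  ultimately have "card (fine_sq k ` ?P) > 0" by (simp add: card_gt_0_iff)
  then show "1 \<le> weight k (piece k x)" unfolding weight_mult[OF x, symmetric] by simp
  have "?P \<subseteq> cluster k x" using conn_if_piece_eq unfolding cluster_def by (metis (mono_tags, lifting) mem_Collect_eq subsetI)
  then have "card (fine_sq k ` ?P) \<le> card (fine_sq k ` cluster k x)"
    using finite_fine_sq[OF cluster_codes[OF x]] by (intro card_mono image_mono)
  then have "weight k (piece k x) * card D \<le> card (sq k (L k) ` cluster k x) * card D"
    unfolding weight_mult[OF x] card_fine_sq_cluster[OF x] .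
  then show "weight k (piece k x) \<le> max_weight" using D_card card_cluster_le[OF x, of k] by simp
qed

lemma finite_piece: "finite (piece k ` codes)"
proof -
  define g where "g p = piece k (SOME x. x \<in> codes \<and> fine_sq k x = p)" for p
  have "piece k x = g (fine_sq k x)" if "x \<in> codes" for x
  proof -
    have "\<exists>y. y \<in> codes \<and> fine_sq k y = fine_sq k x" using that by auto
    then have "(SOME y. y \<in> codes \<and> fine_sq k y = fine_sq k x) \<in> codes \<and>
        fine_sq k (SOME y. y \<in> codes \<and> fine_sq k y = fine_sq k x) = fine_sq k x" by (rule someI_ex)
    then show ?thesis using piece_eq_if_fine_sq_eq[OF that, of _ k] unfolding g_def by metis
  qed
  then have "piece k ` codes \<subseteq> g ` fine_sq k ` codes" by auto
  then show ?thesis using finite_fine_sq[of codes k] finite_subset by blast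
qed

lemma sum_weight:
  assumes P: "P \<subseteq> codes" "\<And>x y. x \<in> P \<Longrightarrow> y \<in> codes \<Longrightarrow> piece k y = piece k x \<Longrightarrow> y \<in> P"
  shows "sum (weight k) (piece k ` P) * card D = card (fine_sq k ` P)"
proof -
  define Q where "Q A = fine_sq k ` {y\<in>codes. piece k y = A}" for A
  have "sum (weight k) (piece k ` P) * card D = (\<Sum>A\<in>piece k ` P. card (Q A))"
    unfolding sum_distrib_right Q_def
  proof (rule sum.cong)
    fix A assume "A \<in> piece k ` P"
    then obtain x where "x \<in> P" "A = piece k x" by blast
    then show "weight k A * card D = card (fine_sq k ` {y\<in>codes. piece k y = A})"
      using weight_mult[of x k] P(1) by auto
  qed simp
  also have "\<dots> = card (\<Union>A\<in>piece k ` P. Q A)"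
  proof (rule card_UN_disjoint[symmetric])
    show "finite (piece k ` P)" by (rule finite_subset[OF image_mono[OF P(1)] finite_piece])
    show "\<forall>A\<in>piece k ` P. finite (Q A)" by (auto simp: Q_def intro!: finite_fine_sq)
    show "\<forall>A\<in>piece k ` P. \<forall>B\<in>piece k ` P. A \<noteq> B \<longrightarrow> Q A \<inter> Q B = {}"
    proof (intro ballI impI, rule ccontr)
      fix A B assume AB: "A \<noteq> B" "Q A \<inter> Q B \<noteq> {}"
      then obtain y z where "y \<in> codes" "z \<in> codes" "piece k y = A" "piece k z = B" "fine_sq k y = fine_sq k z"
        unfolding Q_def by blast
      then show False using piece_eq_if_fine_sq_eq[of y z k] AB(1) by simp
    qed
  qed
  also have "(\<Union>A\<in>piece k ` P. Q A) = fine_sq k ` P"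
  proof
    show "(\<Union>A\<in>piece k ` P. Q A) \<subseteq> fine_sq k ` P" using P(2) unfolding Q_def by blast
    show "fine_sq k ` P \<subseteq> (\<Union>A\<in>piece k ` P. Q A)" using P(1) unfolding Q_def by blast
  qed
  finally show ?thesis .
qed

lemma sum_weight_0: "sum (weight 0) (piece 0 ` codes) = 1"
proof -
  have "sq 0 0 ` codes = {(0, 0)}"
    using D_nonempty by (auto simp: sq_def codes_def image_iff)
  moreover have "cylinder 0 0 codes" by (auto simp: cylinder_def)
  ultimately have "card (fine_sq 0 ` codes) = card D"
    using card_sq[of 0 0 codes 1 1] by (simp add: fine_sq_def card_D)
  then have "sum (weight 0) (piece 0 ` codes) * card D = 1 * card D"
    using sum_weight[of codes 0] by simp
  then show ?thesis by (rule card_D_cancel)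
qed

text \<open>The counting of rectangles in \<open>card_sq\<close>, divided by \<open>card D\<close>. The factor on the right is the product of
  the numbers of children in the generations between \<open>k\<close> and \<open>k'\<close>, see \<open>prod_n_seq\<close>.\<close>

lemma sum_weight_children:
  assumes x: "x \<in> codes" and "k \<le> k'"
  shows "sum (weight k') (piece k' ` {y\<in>codes. piece k y = piece k x}) =
    weight k (piece k x) * (a ^ (k' - k) * s ^ (L k' - L k))"
proof -
  let ?P = "{y\<in>codes. piece k y = piece k x}"
  have "sum (weight k') (piece k' ` ?P) * card D = card (fine_sq k' ` ?P)"
  proof (rule sum_weight)
    fix z y assume "z \<in> ?P" "y \<in> codes" "piece k' y = piece k' z"
    then show "y \<in> ?P" using piece_coarsen[of k' y z k] \<open>k \<le> k'\<close> by simp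
  qed simp
  also have "\<dots> = card (fine_sq k ` ?P) * a ^ (k' - k) * s ^ (L k' - L k)"
    unfolding fine_sq_def using card_sq[OF cylinder_piece[of k "piece k x"], of "Suc k'" "Suc (L k')"] L_mono[OF \<open>k \<le> k'\<close>]
      \<open>k \<le> k'\<close> le_L by simp
  finally have "sum (weight k') (piece k' ` ?P) * card D =
      weight k (piece k x) * (a ^ (k' - k) * s ^ (L k' - L k)) * card D"
    unfolding weight_mult[OF x, symmetric] by (simp add: ac_simps)
  then show ?thesis by (rule card_D_cancel)
qed

end


section \<open>Pieces of weight one\<close>

text \<open>One coordinate of the corner argument. A run of squares extends from \<open>lo\<close> to \<open>hi\<close>; \<open>p\<close> is its lower end,
  with next digit \<open>i < c\<close>, or its upper end, with next digit \<open>i > c\<close>. A neighbour in the run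
  cannot leave the corner, because to do so it has to use the vacant digit \<open>c\<close> or to leave the
  run.\<close>

lemma corner_closed:
  fixes p p' lo hi c b i i' :: nat
  assumes "i' < b" "i \<noteq> c" "i' \<noteq> c" "c < b"
    and p: "p = (if i < c then lo else hi)" and "lo \<le> p'" "p' \<le> hi"
    and "p * b + i \<le> p' * b + i' + 1" "p' * b + i' \<le> p * b + i + 1"
  shows "p' = (if i' < c then lo else hi)"
proof (cases "i < c")
  case True
  have up: "p' * b + i' \<le> lo * b + c" using assms True by simp
  then have "p' * b < (lo + 1) * b" using \<open>c < b\<close> by simp
  then have "p' < lo + 1" by (simp only: mult_less_cancel2)
  then have "p' = lo" using \<open>lo \<le> p'\<close> by simp
  then show ?thesis using up assms by simp
next
  case False
  have low: "hi * b + c \<le> p' * b + i'" using assms False by simp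
  then have "hi * b < (p' + 1) * b" using \<open>i' < b\<close> by simp
  then have "hi < p' + 1" by (simp only: mult_less_cancel2)
  then have "p' = hi" using \<open>p' \<le> hi\<close> by simp
  then show ?thesis using low assms by simp
qed

context uniform_carpet
begin

text \<open>If all codes of the cluster agree in the row digits that govern the first \<open>k + 1\<close> column digits,
  the columns of one and the rows of another code can be combined (\<open>mix\<close>), and a chain of
  touching squares stays one if either coordinate is kept fixed. So the cluster is a product
  of a run of columns and a run of rows. The core consists of the lower-digit part (next digit
  below the vacant one) at the lower ends of the runs and the upper-digit part at the
  upper ends: in either coordinate, each available next digit is used at exactly one
  of the two ends, which gives \<open>a * s\<close> fine squares.\<close>

lemma splits_if_homogeneous:
  assumes y: "y \<in> codes" and kL: "k < L k"
    and hom: "\<And>z t. conn k (L k) y z \<Longrightarrow> t \<le> k \<Longrightarrow> snd (z t) = snd (y t)"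
  shows "\<exists>S. splits k (cluster k y) S"
proof -
  define C where "C = {z. conn k (L k) y z}"
  have Cc: "z \<in> codes" if "z \<in> C" for z using that conn_codes y by (auto simp: C_def)
  have yC: "y \<in> C" by (simp add: C_def)
  have adjC: "w \<in> C" if "z \<in> C" "adj k (L k) z w" for z w using that by (auto simp: C_def)
  have homC: "snd (z t) = snd (y t)" if "z \<in> C" "t \<le> k" for z t using that hom[of z t] by (simp add: C_def)
  define mix where "mix z z' t = (if t \<le> k then (fst (z t), snd (z' t)) else z' t)"
    for z z' :: "nat \<Rightarrow> nat \<times> nat" and t
  have mix_codes: "mix z z' \<in> codes" if "z \<in> C" "z' \<in> C" for z z'
    unfolding codes_def
  proof safe
    fix t
    have "snd (z' t) = snd (z t)" if "t \<le> k" 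
      using homC[OF \<open>z \<in> C\<close> that] homC[OF \<open>z' \<in> C\<close> that] by simp
    then show "mix z z' t \<in> D"
      using codesD[OF Cc[OF \<open>z \<in> C\<close>], of t] codesD[OF Cc[OF \<open>z' \<in> C\<close>], of t] by (simp add: mix_def)
  qed
  have mix_col: "col (mix z z') k = col z k" for z z'
    unfolding col_def by (rule radix_cong) (simp add: mix_def)
  have mix_row: "row (mix z z') l = row z' l" for z z' l
    unfolding row_def by (rule radix_cong) (simp add: mix_def)
  have mix1: "conn k (L k) (mix y z') (mix z z')" if "z \<in> C" "z' \<in> C" for z z'
  proof -
    have "conn k (L k) y z" using that by (simp add: C_def)
    then show ?thesis
    proof (induction rule: rtranclp_induct)
      case (step u w)
      have uw: "u \<in> C" "w \<in> C" using step(1,2) by (auto simp: C_def)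
      have "adj k (L k) (mix u z') (mix w z')"
        using step(2) mix_codes[OF uw(1) that(2)] mix_codes[OF uw(2) that(2)]
        by (simp add: adj_def near_def sq_def mix_col mix_row)
      then show ?case using step(3) by simp
    qed simp
  qed
  have mix2: "conn k (L k) (mix y y) (mix y z')" if "z' \<in> C" for z'
  proof -
    have "conn k (L k) y z'" using that by (simp add: C_def)
    then show ?thesis
    proof (induction rule: rtranclp_induct)
      case (step u w)
      have uw: "u \<in> C" "w \<in> C" using step(1,2) by (auto simp: C_def)
      have "adj k (L k) (mix y u) (mix y w)"
        using step(2) mix_codes[OF yC uw(1)] mix_codes[OF yC uw(2)]
        by (simp add: adj_def near_def sq_def mix_col mix_row)
      then show ?case using step(3) by simp
    qed simp
  qed
  have "mix y y = y" by (auto simp: mix_def)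
  then have mixC: "mix z z' \<in> C" if "z \<in> C" "z' \<in> C" for z z'
    using mix1[OF that] mix2[OF that(2)] unfolding C_def by auto
  obtain z1 where z1: "z1 \<in> C" "\<And>z. z \<in> C \<Longrightarrow> col z1 k \<le> col z k"
    using ex_has_least_nat[of "\<lambda>z. z \<in> C" y "\<lambda>z. col z k"] yC by blast
  obtain z2 where z2: "z2 \<in> C" "\<And>z. z \<in> C \<Longrightarrow> col z k \<le> col z2 k"
    using ex_has_greatest_nat[of "\<lambda>z. z \<in> C" y "\<lambda>z. col z k" "n ^ k"] yC col_less[OF Cc] by blast
  obtain z3 where z3: "z3 \<in> C" "\<And>z. z \<in> C \<Longrightarrow> row z3 (L k) \<le> row z (L k)"
    using ex_has_least_nat[of "\<lambda>z. z \<in> C" y "\<lambda>z. row z (L k)"] yC by blast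
  obtain z4 where z4: "z4 \<in> C" "\<And>z. z \<in> C \<Longrightarrow> row z (L k) \<le> row z4 (L k)"
    using ex_has_greatest_nat[of "\<lambda>z. z \<in> C" y "\<lambda>z. row z (L k)" "m ^ L k"] yC row_less[OF Cc] by blast
  define j where "j = snd (y k)"
  have yk: "(fst (y k), j) \<in> D" using codesD[OF y, of k] by (simp add: j_def)
  obtain c where c: "c < n" "(c, j) \<notin> D"
  proof -
    have "card {i. (i, j) \<in> D} < card {..<n}" using fiber[OF yk] a_less by simp
    then have "\<not> {..<n} \<subseteq> {i. (i, j) \<in> D}" using card_mono[OF finite_fiber] by (metis linorder_not_le)
    then show thesis using that by auto
  qed
  define g where "g p = ((if fst p < c then col z1 k else col z2 k) * n + fst p,
      (if snd p < v then row z3 (L k) else row z4 (L k)) * m + snd p)" for p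
  define I where "I = {i. (i, j) \<in> D}"
  define S where "S = g ` (I \<times> J)"
  have I: "i < n" "i \<noteq> c" if "i \<in> I" for i using that c digit_less by (auto simp: I_def)
  have Jv: "j' < m" "j' \<noteq> v" if "j' \<in> J" for j' using that vacant J_less by (auto simp: J_def)
  have g_mod: "fst (g p) mod n = fst p \<and> snd (g p) mod m = snd p" if "p \<in> I \<times> J" for p
  proof -
    have "fst p < n" "snd p < m" using that I Jv by auto
    then show ?thesis by (simp add: g_def)
  qed
  have "inj_on g (I \<times> J)"
  proof (rule inj_onI)
    fix p p' assume "p \<in> I \<times> J" "p' \<in> I \<times> J" "g p = g p'"
    then show "p = p'" using g_mod[of p] g_mod[of p'] by (simp add: prod_eq_iff)
  qed
  then have cS: "card S = card D"
    using fiber[OF yk] by (simp add: S_def card_image card_cartesian_product I_def card_D s_def)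
  have SC: "S \<subseteq> fine_sq k ` C"
  proof
    fix r assume "r \<in> S"
    then obtain i d where i: "(i, j) \<in> D" and d: "d \<in> D" "r = g (i, snd d)" by (auto simp: S_def I_def J_def)
    define z where "z = (if i < c then z1 else z2)"
    define z' where "z' = (if snd d < v then z3 else z4)"
    have zC: "z \<in> C" "z' \<in> C" using z1 z2 z3 z4 by (auto simp: z_def z'_def)
    define w where "w = mix z z'"
    have w: "w \<in> C" "w \<in> codes" using mixC[OF zC] mix_codes[OF zC] by (auto simp: w_def)
    \<comment> \<open>Two different positions are changed, since \<open>k < L k\<close>.\<close>
    define w' where "w' = w(k := (i, j), L k := d)"
    have w'c: "w' \<in> codes" unfolding w'_def using w i d by (intro code_upd)
    have "snd (w k) = j" using homC[OF w(1), of k] by (simp add: j_def)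
    then have r1: "row w' (L k) = row w (L k)"
      by (simp add: w'_def row_upd row_upd_same)
    have c1: "col w' k = col w k" using kL by (simp add: w'_def col_upd)
    \<comment> \<open>The changes are not visible in the squares of generation \<open>k\<close>.\<close>
    have "adj k (L k) w w'" using adj_if_sq_eq[OF w(2) w'c] r1 c1 by (simp add: sq_def)
    then have "w' \<in> C" using adjC w by blast
    moreover have "fine_sq k w' = r"
    proof -
      have "fst (w' k) = i" "snd (w' (L k)) = snd d" using kL by (auto simp: w'_def)
      then show ?thesis unfolding d(2) fine_sq_def sq_def g_def using r1 c1
        by (simp add: w_def mix_col mix_row z_def z'_def)
    qed
    ultimately show "r \<in> fine_sq k ` C" by blast
  qed
  have "fine_sq k x' \<in> S" if adj: "adj (Suc k) (Suc (L k)) x x'" and xS: "fine_sq k x \<in> S" for x x'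
  proof -
    have xc: "x \<in> codes" "x' \<in> codes" using adj by (auto simp: adj_def)
    obtain x0 where x0: "x0 \<in> C" "fine_sq k x0 = fine_sq k x" using xS SC by auto
    have "sq k (L k) x0 = sq k (L k) x"
      using sq_coarsen[OF x0(2)[unfolded fine_sq_def]] Cc[OF x0(1)] xc by simp
    then have "x \<in> C" using adjC[OF x0(1)] adj_if_sq_eq[OF Cc[OF x0(1)] xc(1)] by blast
    then have x'C: "x' \<in> C" using adjC adj_coarsen[OF adj, of k "L k"] by auto
    obtain p where p: "p \<in> I \<times> J" "fine_sq k x = g p" using xS by (auto simp: S_def)
    have pb: "fst p < n" "snd p < m" "fst p \<noteq> c" "snd p \<noteq> v" 
      using p(1) I[of "fst p"] Jv[of "snd p"] by (auto simp: mem_Times_iff)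
    have e1: "col x k * n + fst (x k) = (if fst p < c then col z1 k else col z2 k) * n + fst p"
      and e2: "row x (L k) * m + snd (x (L k)) = (if snd p < v then row z3 (L k) else row z4 (L k)) * m + snd p"
      using p(2) by (simp_all add: fine_sq_def sq_def g_def)
    have i': "(fst (x' k), j) \<in> D"
      using codesD[OF xc(2), of k] homC[OF x'C, of k] by (metis j_def order_refl prod.collapse)
    have j': "snd (x' (L k)) \<in> J" using codesD[OF xc(2), of "L k"] by (simp add: J_def)
    have near: "col x k * n + fst (x k) \<le> col x' k * n + fst (x' k) + 1"
      "col x' k * n + fst (x' k) \<le> col x k * n + fst (x k) + 1"
      "row x (L k) * m + snd (x (L k)) \<le> row x' (L k) * m + snd (x' (L k)) + 1"
      "row x' (L k) * m + snd (x' (L k)) \<le> row x (L k) * m + snd (x (L k)) + 1"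
      using adj by (auto simp: adj_def near_def sq_def)
    have i'b: "fst (x' k) < n" "fst (x' k) \<noteq> c" using i' I[of "fst (x' k)"] by (auto simp: I_def)
    note j'b = Jv[OF j']
    have "col x' k = (if fst (x' k) < c then col z1 k else col z2 k)"
      by (rule corner_closed[where i = "fst p" and b = n and i' = "fst (x' k)" and c = c and p = "if fst p < c then col z1 k else col z2 k"])
        (use pb c(1) i'b near(1,2)[unfolded e1] z1(2)[OF x'C] z2(2)[OF x'C] in simp_all)
    moreover have "row x' (L k) = (if snd (x' (L k)) < v then row z3 (L k) else row z4 (L k))"
      by (rule corner_closed[where i = "snd p" and b = m and i' = "snd (x' (L k))" and c = v and p = "if snd p < v then row z3 (L k) else row z4 (L k)"])
        (use pb v_less j'b near(3,4)[unfolded e2] z3(2)[OF x'C] z4(2)[OF x'C] in simp_all)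
    ultimately have "fine_sq k x' = g (fst (x' k), snd (x' (L k)))"
      unfolding fine_sq_def sq_def g_def by simp
    then show ?thesis using i' j' by (auto simp: S_def I_def)
  qed
  then have "splits k C S" using SC cS unfolding splits_def by blast
  then show ?thesis by (auto simp: C_def cluster_def)
qed

text \<open>If there is only one non-vacant row, all codes have the same row digits. Otherwise two row digits
  \<open>c < c'\<close> are inserted behind the first \<open>L k\<close> ones. They place the square neither in the lowest nor
  in the highest of the \<open>m\<^sup>2\<close> rows, so that a cluster, which extends to neighbouring rows of that
  size at most, does not leave the row of type \<open>L k\<close>; the digits up to position \<open>k + 3\<close>
  are among the first \<open>L k\<close> ones.\<close>

lemma ex_split_below:
  assumes x: "x \<in> codes" and far: "k + 4 \<le> L k"
  shows "\<exists>y\<in>codes. sq k (L k) y = sq k (L k) x \<and> (\<exists>S. splits (k + 3) (cluster (k + 3) y) S)"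
proof (cases "\<exists>c\<in>J. \<exists>c'\<in>J. c < c'")
  case False
  have "snd (z t) = snd (x t)" if "conn (k + 3) (L (k + 3)) x z" for z t
  proof -
    have "snd (z t) \<in> J" "snd (x t) \<in> J"
      using codesD[OF conn_codes[OF that x], of t] codesD[OF x, of t] by (auto simp: J_def)
    then show ?thesis using False by (meson linorder_neqE_nat)
  qed
  moreover have "k + 3 < L (k + 3)" using far L_add[of k 3] by linarith
  ultimately have "\<exists>S. splits (k + 3) (cluster (k + 3) x) S"
    by (intro splits_if_homogeneous[OF x])
  then show ?thesis using x by blast
next
  case True
  then obtain d d' where d: "d \<in> D" "d' \<in> D" "snd d < snd d'" by (auto simp: J_def)
  define l where "l = L k"
  define y where "y = x(l := d, Suc l := d')"
  have y: "y \<in> codes" unfolding y_def using x d by (intro code_upd)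
  have "k \<le> l" using far by (simp add: l_def)
  then have sq: "sq k l y = sq k l x" by (simp add: y_def sq_def col_upd row_upd)
  define R where "R = snd d * m + snd d'"
  have d'm: "snd d' < m" using d digit_less by blast
  have rowy: "row y (l + 2) = row y l * m\<^sup>2 + R"
    by (simp add: y_def R_def power2_eq_square algebra_simps)
  have "R \<ge> 1" using d by (simp add: R_def)
  have "R + 1 < m\<^sup>2"
  proof -
    have "snd d + 1 \<le> m - 1" using d d'm by simp
    then have "(snd d + 1) * m \<le> (m - 1) * m" by (intro mult_right_mono) auto
    then have "R + 1 \<le> (m - 1) * m" using d'm by (simp add: R_def)
    also have "\<dots> < m * m" using m2 by simp
    finally show ?thesis by (simp add: power2_eq_square)
  qed
  have "snd (z t) = snd (y t)" if z: "conn (k + 3) (L (k + 3)) y z" and t: "t \<le> k + 3" for z t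
  proof -
    have zc: "z \<in> codes" using conn_codes z y by blast
    have "conn (k + 3) (l + 3) y z"
      using conn_coarsen[OF z order_refl, of "l + 3"] L_add[of k 3] by (simp add: l_def)
    then have "row y (l + 3) < row z (l + 3) + m" "row z (l + 3) < row y (l + 3) + m"
      using conn_row_less conn_sym by blast+
    then have "row y (l + 3) div m \<le> (row z (l + 3) + m) div m" "row z (l + 3) div m \<le> (row y (l + 3) + m) div m"
      by (simp_all only: div_le_mono less_imp_le)
    then have "row y (l + 2) \<le> row z (l + 2) + 1" "row z (l + 2) \<le> row y (l + 2) + 1"
      using row_div[OF y, of "l + 2" "l + 3"] row_div[OF zc, of "l + 2" "l + 3"] m2 by simp_all
    then have "row y l * m\<^sup>2 \<le> row z (l + 2)" "row z (l + 2) < Suc (row y l) * m\<^sup>2"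
      using rowy \<open>R \<ge> 1\<close> \<open>R + 1 < m\<^sup>2\<close> by simp_all
    then have "row z (l + 2) div m\<^sup>2 = row y l" by (intro div_nat_eqI) (simp_all add: mult.commute)
    then have "row z l = row y l" using row_div[OF zc, of l "l + 2"] by simp
    moreover have "t < l" using t far by (simp add: l_def)
    ultimately show ?thesis using row_eq_iff[OF zc y] by blast
  qed
  moreover have "k + 3 < L (k + 3)" using far L_add[of k 3] by linarith
  ultimately have "\<exists>S. splits (k + 3) (cluster (k + 3) y) S"
    by (intro splits_if_homogeneous[OF y])
  then show ?thesis using y sq unfolding l_def by blast
qed

lemma piece_eq_if_conn:
  assumes "conn k' (L k') x y" "k < k'"
  shows "piece k x = piece k y"
  using assms(1)
proof (induction rule: rtranclp_induct)
  case (step y z)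
  have "Suc (L k) \<le> L k'" using L_Suc[of k] L_mono[of "Suc k" k'] assms(2) by simp
  then have "adj (Suc k) (Suc (L k)) y z" using adj_coarsen[OF step(2)] assms(2) by simp
  then show ?case using adj_piece step(3) by simp
qed simp

text \<open>The piece of \<open>x\<close> contains at least \<open>2 ^ (R - 4)\<close> squares of generation \<open>k + R - 3\<close>, by
  counting. Each of them meets a cluster of generation \<open>k + R\<close> that has a core, and one
  cluster meets at most \<open>max_weight\<close> of them.\<close>

lemma many_unit_pieces:
  assumes x: "x \<in> codes" and far: "\<And>i. k0 \<le> i \<Longrightarrow> i + 4 \<le> L i" and R: "4 + k0 \<le> R"
  shows "2 ^ (R - 4) \<le>
    card {B \<in> piece (k + R) ` {y\<in>codes. piece k y = piece k x}. weight (k + R) B = 1} * max_weight"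
proof -
  let ?O = "{B \<in> piece (k + R) ` {y\<in>codes. piece k y = piece k x}. weight (k + R) B = 1}"
  \<comment> \<open>The generation whose squares contain clusters with a core three generations later.\<close>
  define K where "K = k + R - 3"
  have K: "k0 \<le> K" "Suc k \<le> K" "K + 3 = k + R" "K = Suc k + (R - 4)" using R by (auto simp: K_def)
  have LK: "Suc (L k) + (R - 4) \<le> L K" using L_add[of "Suc k" "R - 4"] L_Suc[of k] K(4) by simp
  define P where "P = {z\<in>codes. fine_sq k z = fine_sq k x}"
  define Z where "Z = sq K (L K) ` P"
  have Pc: "P \<subseteq> codes" by (auto simp: P_def)
  have finZ: "finite Z" unfolding Z_def using Pc by (rule finite_sq)
  have cylP: "cylinder (Suc k) (Suc (L k)) P" unfolding P_def fine_sq_def by (rule cylinder_square)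
  have "sq (Suc k) (Suc (L k)) ` P = {fine_sq k x}" using x by (auto simp: P_def fine_sq_def)
  then have "card Z = a ^ (K - Suc k) * s ^ (L K - Suc (L k))"
    unfolding Z_def using card_sq[OF cylP, of K "L K"] le_L K LK by simp
  moreover have "s ^ (R - 4) \<le> s ^ (L K - Suc (L k))"
    using LK s_pos by (intro power_increasing) auto
  moreover have "2 ^ (R - 4) \<le> card D ^ (R - 4)" using D_card by (intro power_mono) auto
  ultimately have cZ: "2 ^ (R - 4) \<le> card Z"
    using K(4) by (simp add: card_D power_mult_distrib mult.commute)
      (meson mult_le_mono1 order_trans mult_le_mono2)
  have "\<exists>y. y \<in> codes \<and> sq K (L K) y = p \<and> (\<exists>S. splits (k + R) (cluster (k + R) y) S)" if p: "p \<in> Z" for p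
  proof -
    obtain z where z: "z \<in> P" "p = sq K (L K) z" using p unfolding Z_def by blast
    then show ?thesis using ex_split_below[of z K] Pc far[OF K(1)] K(3) by auto
  qed
  then obtain Y where Y: "\<And>p. p \<in> Z \<Longrightarrow> Y p \<in> codes"
      "\<And>p. p \<in> Z \<Longrightarrow> sq K (L K) (Y p) = p"
      "\<And>p. p \<in> Z \<Longrightarrow> \<exists>S. splits (k + R) (cluster (k + R) (Y p)) S" by metis
  define A where "A p = (cluster (k + R) (Y p), True)" for p
  have AO: "A p \<in> ?O" if p: "p \<in> Z" for p
  proof -
    have w1: "weight (k + R) (A p) = 1" unfolding A_def by (rule weight_core[OF Y(1,3)[OF p]])
    have "{y\<in>codes. piece (k + R) y = A p} \<noteq> {}"
    proof
      assume empty: "{y\<in>codes. piece (k + R) y = A p} = {}"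
      show False using w1 unfolding weight_def empty by simp
    qed
    then obtain w where w: "w \<in> codes" "piece (k + R) w = A p" by auto
    have "conn (k + R) (L (k + R)) (Y p) w"
      using w(2) self_in_cluster[of w "k + R"] by (auto simp: A_def piece_def cluster_def)
    then have "piece k (Y p) = piece k w" by (rule piece_eq_if_conn) (use R in simp)
    moreover have "piece k (Y p) = piece k x"
    proof -
      obtain z where z: "z \<in> P" "p = sq K (L K) z" using p unfolding Z_def by blast
      have zc: "z \<in> codes" using z Pc by blast
      have "sq (Suc k) (Suc (L k)) (Y p) = sq (Suc k) (Suc (L k)) z"
        by (rule sq_coarsen[of K "L K"]) (use Y(1,2)[OF p] z zc K LK in auto)
      then have "fine_sq k (Y p) = fine_sq k x" using z by (simp add: P_def fine_sq_def)
      then show ?thesis by (rule piece_eq_if_fine_sq_eq[OF Y(1)[OF p] x])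
    qed
    ultimately have wx: "w \<in> {y\<in>codes. piece k y = piece k x}" using w by simp
    have "A p \<in> piece (k + R) ` {y\<in>codes. piece k y = piece k x}"
      unfolding w(2)[symmetric] by (rule imageI[OF wx])
    then show ?thesis using w1 by simp
  qed
  have fiber_le: "card {q\<in>Z. A q = A p} \<le> max_weight" if p: "p \<in> Z" for p
  proof -
    define h where "h r = (fst r div n ^ (k + R - K), snd r div m ^ (L (k + R) - L K))" for r :: "nat \<times> nat"
    let ?C = "sq (k + R) (L (k + R)) ` cluster (k + R) (Y p)"
    have "{q\<in>Z. A q = A p} \<subseteq> h ` ?C"
    proof
      fix q assume "q \<in> {q\<in>Z. A q = A p}"
      then have q: "q \<in> Z" "cluster (k + R) (Y q) = cluster (k + R) (Y p)" by (auto simp: A_def)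
      have Yq: "Y q \<in> cluster (k + R) (Y p)" using q(2) self_in_cluster[of "Y q" "k + R"] by simp
      have hq: "h (sq (k + R) (L (k + R)) (Y q)) = q"
        using Y(2)[OF q(1)] col_div[OF Y(1)[OF q(1)], of K "k + R"]
          row_div[OF Y(1)[OF q(1)], of "L K" "L (k + R)"] L_mono[of K "k + R"] K(3)
        by (simp add: h_def sq_def)
      show "q \<in> h ` ?C" by (subst hq[symmetric]) (intro imageI Yq)
    qed
    moreover have fC: "finite ?C" by (rule finite_sq[OF cluster_codes[OF Y(1)[OF p]]])
    ultimately have "card {q\<in>Z. A q = A p} \<le> card (h ` ?C)" by (intro card_mono) auto
    also have "\<dots> \<le> card ?C" using fC by (rule card_image_le)
    also have "\<dots> \<le> max_weight" by (rule card_cluster_le[OF Y(1)[OF p]])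
    finally show ?thesis .
  qed
  have "card Z \<le> card (A ` Z) * max_weight" using finZ fiber_le by (rule card_le_fibers)
  also have "card (A ` Z) \<le> card ?O"
  proof (rule card_mono)
    show "finite ?O"
      by (rule finite_subset[OF _ finite_piece[of "k + R"]]) auto
    show "A ` Z \<subseteq> ?O" using AO by blast
  qed
  then have "card (A ` Z) * max_weight \<le> card ?O * max_weight" by simp
  finally show ?thesis using cZ by linarith
qed

end


section \<open>The sequence space of the carpet\<close>

context uniform_carpet
begin

lemma max_weight_pos: "max_weight > 0" using n2 m2 by (simp add: max_weight_def)

text \<open>Only every \<open>R\<close>-th generation is used. Since \<open>R\<close> exceeds the cube of the bound for the weights, each piece has
  enough descendants of weight one \<open>R\<close> generations later.\<close>

lemma carpet_equivalent_block_space: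
  "\<exists>R>0. \<forall>q. (\<forall>k. q (Suc k) = a ^ R * s ^ (L (k * R + R) - L (k * R))) \<longrightarrow>
    lipschitz_equivalent E dist (seq_space q) (seq_dist ((1 / real n) ^ R))"
proof -
  obtain k0 where k0: "\<And>i. k0 \<le> i \<Longrightarrow> i + 4 \<le> L i" using eventually_L_far by blast
  define R where "R = 4 + k0 + max_weight * max_weight * max_weight"
  have R: "4 + k0 \<le> R" "R > 0" by (auto simp: R_def)
  have "max_weight * max_weight * max_weight < 2 ^ (max_weight * max_weight * max_weight)" by (rule less_exp)
  also have "\<dots> \<le> (2::nat) ^ (R - 4)" by (intro power_increasing) (auto simp: R_def)
  finally have big: "max_weight * max_weight * max_weight \<le> 2 ^ (R - 4)" by simp
  have "lipschitz_equivalent (pt ` codes) dist (seq_space q) (seq_dist ((1 / real n) ^ R))"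
    if q: "\<And>k. q (Suc k) = a ^ R * s ^ (L (k * R + R) - L (k * R))" for q
  proof (rule lipschitz_equivalent_of_weighted_tree[where I = "\<lambda>k. piece (k * R)"
        and w = "\<lambda>k. weight (k * R)" and M = max_weight and c = "1 / real n"
        and C = "2 * real n ^ gap_exp + 1 + real m * (real m + 1)"
        and b = "\<lambda>k. a ^ R * s ^ (L (k * R + R) - L (k * R))"])
    show "0 < (1 / real n) ^ R" "0 < 1 / real n" using n2 by auto
    show "(1 / real n) ^ R < 1" 
      using power_strict_decreasing[of 0 R "1 / real n"] n2 R(2) by simp
    show "compact (pt ` codes)" unfolding pt_image by (rule attractor(2))
    have pow: "((1 / real n) ^ R) ^ k = (1 / real n) ^ (k * R)" for k
      by (simp add: power_mult[symmetric] mult.commute)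
    show "piece (k * R) x = piece (k * R) y"
      if "x \<in> codes" "y \<in> codes" "piece (Suc k * R) x = piece (Suc k * R) y" for k x y
      using that(3) by (rule piece_coarsen) simp
    show "dist (pt x) (pt y) \<le> (2 * real n ^ gap_exp + 1 + real m * (real m + 1)) * ((1 / real n) ^ R) ^ k"
      if "x \<in> codes" "y \<in> codes" "piece (k * R) x = piece (k * R) y" for k x y
      unfolding pow by (rule conn_dist[OF that(1) conn_if_piece_eq[OF that(3)]])
    show "1 / real n * ((1 / real n) ^ R) ^ k \<le> dist (pt x) (pt y)"
      if "x \<in> codes" "y \<in> codes" "piece (k * R) x \<noteq> piece (k * R) y" for k x y
    proof -
      have "\<not> adj (Suc (k * R)) (Suc (L (k * R))) x y" using adj_piece that(3) by blast
      from not_adj_dist[OF that(1,2) this] show ?thesis unfolding pow by simp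
    qed
    show "finite (piece (k * R) ` codes)" for k by (rule finite_piece)
    show "1 \<le> weight (k * R) (piece (k * R) x) \<and> weight (k * R) (piece (k * R) x) \<le> max_weight"
      if "x \<in> codes" for k x using that by (rule weight_bounds)
    show "sum (weight (0 * R)) (piece (0 * R) ` codes) = 1" using sum_weight_0 by simp
    have Suc_mult: "Suc k * R = k * R + R" for k by simp
    show "sum (weight (Suc k * R)) (piece (Suc k * R) ` {y\<in>codes. piece (k * R) y = piece (k * R) x}) =
        weight (k * R) (piece (k * R) x) * (a ^ R * s ^ (L (k * R + R) - L (k * R)))"
      if "x \<in> codes" for k x
      unfolding Suc_mult using sum_weight_children[OF that, of "k * R" "k * R + R"] by simp
    show "weight (k * R) (piece (k * R) x) * max_weight \<le> card {B \<in> piece (Suc k * R) `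
        {y\<in>codes. piece (k * R) y = piece (k * R) x}. weight (Suc k * R) B = 1}"
      if x: "x \<in> codes" for k x
    proof -
      let ?c = "card {B \<in> piece (k * R + R) `
        {y\<in>codes. piece (k * R) y = piece (k * R) x}. weight (k * R + R) B = 1}"
      have "max_weight * max_weight * max_weight \<le> ?c * max_weight" using many_unit_pieces[OF x k0 R(1), of "k * R"] big by linarith
      then have "max_weight * max_weight \<le> ?c" using max_weight_pos by simp
      moreover have "weight (k * R) (piece (k * R) x) * max_weight \<le> max_weight * max_weight"
        using weight_bounds[OF x] by simp
      ultimately show ?thesis unfolding Suc_mult by linarith
    qed
    show "q (Suc k) = a ^ R * s ^ (L (k * R + R) - L (k * R))" for k by (rule q)
  qed
  then show ?thesis unfolding pt_image using R(2) by blast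
qed

lemma num_rows_eq: "num_rows m D = s"
proof -
  have "row_count D j > 0 \<longleftrightarrow> j \<in> J" for j
    unfolding row_count_def card_gt_0_iff J_def using finite_fiber[of j] by force
  then have "{j. j < m \<and> row_count D j > 0} = J" using J_less by auto
  then show ?thesis by (simp add: num_rows_def s_def)
qed

text \<open>The exponents of the factors of \<open>\<Omega>\<close> telescope: their sum up to \<open>k\<close> is \<open>L k - k\<close>, because \<open>k / \<sigma>\<close> and
  \<open>k * \<alpha>\<close> differ by the integer \<open>k * \<lfloor>1 / \<sigma>\<rfloor>\<close>.\<close>

lemma n_seq_Suc: "n_seq n m D (Suc t) = a * s ^ (L (Suc t) - L t)"
proof -
  define \<tau> where "\<tau> = 1 / sigma_nm n m"
  have L: "\<lfloor>real k / sigma_nm n m\<rfloor> = int (L k)" for k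
    using sigma_pos by (simp add: L_def)
  have fl: "\<lfloor>real k * alpha n m\<rfloor> = int (L k) - int k * \<lfloor>\<tau>\<rfloor>" for k
  proof -
    have "real k * alpha n m = real k / sigma_nm n m - of_int (int k * \<lfloor>\<tau>\<rfloor>)"
      by (simp add: alpha_def \<tau>_def right_diff_distrib)
    then show ?thesis by (simp only: floor_diff_of_int L)
  qed
  have "delta n m (Suc t) = \<lfloor>real (Suc t) * alpha n m\<rfloor> - \<lfloor>real t * alpha n m\<rfloor>"
    by (simp add: delta_def)
  also have "\<dots> = int (L (Suc t)) - int (L t) - \<lfloor>\<tau>\<rfloor>"
    unfolding fl by (simp add: algebra_simps)
  finally have "\<lfloor>1 / sigma_nm n m\<rfloor> + delta n m (Suc t) - 1 = int (L (Suc t)) - int (L t) - 1"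
    by (simp add: \<tau>_def)
  then have "nat (\<lfloor>1 / sigma_nm n m\<rfloor> + delta n m (Suc t) - 1) = L (Suc t) - L t - 1"
    using L_Suc[of t] by simp
  then have "n_seq n m D (Suc t) = a * (s * s ^ (L (Suc t) - L t - 1))"
    by (simp add: n_seq_def card_D num_rows_eq mult.commute mult.left_commute)
  also have "s * s ^ (L (Suc t) - L t - 1) = s ^ (L (Suc t) - L t)"
    using power_minus_mult[of "L (Suc t) - L t" s] L_Suc[of t] by (simp add: mult.commute)
  finally show ?thesis .
qed

lemma prod_n_seq: "(\<Prod>i<R. n_seq n m D (Suc (k + i))) = a ^ R * s ^ (L (k + R) - L k)"
proof (induction R)
  case (Suc R)
  have "L k \<le> L (k + R)" "L (k + R) \<le> L (Suc (k + R))" by (simp_all add: L_mono)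
  then have "s ^ (L (k + R) - L k) * s ^ (L (Suc (k + R)) - L (k + R)) = s ^ (L (Suc (k + R)) - L k)"
    by (simp add: power_add[symmetric])
  then show ?case using Suc by (simp add: n_seq_Suc mult.assoc mult.left_commute)
qed simp

lemma carpet_equivalent_n_seq:
  "lipschitz_equivalent E dist (seq_space (n_seq n m D)) (seq_dist (1 / real n))"
proof -
  obtain R where R: "R > 0" "\<And>q. (\<And>k. q (Suc k) = a ^ R * s ^ (L (k * R + R) - L (k * R))) \<Longrightarrow>
    lipschitz_equivalent E dist (seq_space q) (seq_dist ((1 / real n) ^ R))"
    using carpet_equivalent_block_space by blast
  define q where "q k = (\<Prod>i<R. n_seq n m D (Suc ((k - 1) * R + i)))" for k
  have "lipschitz_equivalent E dist (seq_space q) (seq_dist ((1 / real n) ^ R))"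
    by (rule R(2)) (simp add: q_def prod_n_seq)
  moreover have "lipschitz_equivalent (seq_space (n_seq n m D)) (seq_dist (1 / real n))
      (seq_space q) (seq_dist ((1 / real n) ^ R))"
    by (rule lipschitz_equivalent_blocks) (use n2 R(1) in \<open>auto simp: q_def\<close>)
  ultimately show ?thesis using lipschitz_equivalent_sym lipschitz_equivalent_trans by blast
qed

lemma carpet_equivalent_rational:
  assumes "p > 0" "q > 0" "sigma_nm n m = real p / real q"
  shows "lipschitz_equivalent E dist
    (seq_space (\<lambda>k. card D ^ p * num_rows m D ^ (q - p))) (seq_dist (1 / real n ^ p))"
proof -
  have "p < q" using sigma_less_1 assms by simp
  have L: "L (k * p) = k * q" for k
  proof -
    have "real (k * p) / sigma_nm n m = real (k * q)" using assms(1,2) unfolding assms(3) by simp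
    then show ?thesis unfolding L_def by (simp only: floor_of_nat nat_int)
  qed
  have "card D ^ p * num_rows m D ^ (q - p) = (\<Prod>i<p. n_seq n m D (Suc (k * p + i)))" for k
  proof -
    have "L (k * p + p) - L (k * p) = q" using L[of "Suc k"] L[of k] by (simp add: add.commute)
    moreover have "s ^ q = s ^ p * s ^ (q - p)" using \<open>p < q\<close> by (simp add: power_add[symmetric])
    ultimately show ?thesis
      by (simp add: prod_n_seq card_D num_rows_eq power_mult_distrib mult.commute mult.left_commute)
  qed
  then have "lipschitz_equivalent (seq_space (n_seq n m D)) (seq_dist (1 / real n))
     (seq_space (\<lambda>k. card D ^ p * num_rows m D ^ (q - p))) (seq_dist ((1 / real n) ^ p))"
    by (intro lipschitz_equivalent_blocks) (use n2 assms in auto)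
  then show ?thesis
    using lipschitz_equivalent_trans[OF carpet_equivalent_n_seq] by (simp add: power_one_over)
qed

end


theorem theorem1p1:
  fixes n m :: nat and D :: "(nat \<times> nat) set" and E :: "(real \<times> real) set"
  assumes "2 \<le> m" and "m < n"
    and "D \<subseteq> {0..<n} \<times> {0..<m}" and "card D > 1"
    and "E = carpet n m D" and "in_M_tvr n m D"
  shows "lipschitz_equivalent E dist (seq_space (n_seq n m D)) (seq_dist (1 / real n)) \<and>
    (\<forall>p q :: nat. p > 0 \<longrightarrow> q > 0 \<longrightarrow> sigma_nm n m = real p / real q \<longrightarrow>
       lipschitz_equivalent E dist
         (seq_space (\<lambda>k. card D ^ p * num_rows m D ^ (q - p))) (seq_dist (1 / real n ^ p)))"
proof -
  interpret carpet_coding n m D using assms(1-4) by unfold_locales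
  have fin: "finite {i. (i, j) \<in> D}" for j
    by (rule finite_subset[of _ "{..<n}"]) (use digit_less in auto)
  have pos: "row_count D j \<noteq> 0 \<longleftrightarrow> (\<exists>i. (i, j) \<in> D)" for j
    using fin[of j] by (auto simp: row_count_def)
  obtain v where v: "v < m" "row_count D v = 0"
    using assms(6) by (auto simp: in_M_tvr_def has_vacant_row_def)
  obtain i0 j0 where ij0: "(i0, j0) \<in> D" using D_nonempty by auto
  define a where "a = row_count D j0"
  have fib: "card {i'. (i', j) \<in> D} = a" if "(i, j) \<in> D" for i j
  proof -
    have "j < m" "j0 < m" using digit_less(2) that ij0 by fastforce+
    moreover have "row_count D j \<noteq> 0" "row_count D j0 \<noteq> 0" using pos that ij0 by blast+
    ultimately have "row_count D j = a"
      using assms(6) unfolding in_M_tvr_def uniform_horizontal_fibers_def a_def by blast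
    then show ?thesis by (simp add: row_count_def)
  qed
  have "a < n"
  proof (rule ccontr)
    assume "\<not> a < n"
    moreover have sub: "{i. (i, j0) \<in> D} \<subseteq> {..<n}" using digit_less by auto
    ultimately have "{i. (i, j0) \<in> D} = {..<n}"
      by (intro card_seteq) (auto simp: a_def row_count_def)
    then have "\<not> totally_disconnected (carpet n m D)"
      by (intro not_totally_disconnected_if_full_row[of j0]) auto
    then show False using assms(6) by (simp add: in_M_tvr_def)
  qed
  moreover have "(i, v) \<notin> D" for i using v(2) pos by blast
  ultimately interpret uniform_carpet n m D v a
    using v(1) fib by unfold_locales
  show ?thesis
    unfolding assms(5) using carpet_equivalent_n_seq carpet_equivalent_rational by blast
qed

end
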